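(* Let $R$ be a commutative ring and let $n \geq 0$. There exists an ordered basis $\mathcal{B}_1$ of $\Lambda_1(R^{n+1})$ such that for all $x=(p,a,f,b) \in R^{n+1}\oplus (R^{n+1})^\vee = R^{n+1}\oplus R^{n+1}$ (with $p \in R^n$, $a \in R$, $f \in (R^n)^\vee = R^n$, $b \in R^\vee = R$), the matrices representing the endomorphisms $S(x)$ and $\overline{S(x)}$ of $\Lambda_1(R^{n+1})$ with respect to $\mathcal{B}_1$ are $S_{n+1}(b,f,a,p)$ and $\overline{S_{n+1}(b,f,a,p)}$, respectively.
   Context: $R$ is a commutative ring; $R^m$ is identified with $(R^m)^\vee$ via the standard basis and its dual basis. Suslin matrices: for $m\ge 1$ and $u=(u_1,\dots,u_m), v=(v_1,\dots,v_m)\in R^m$, the $2^{m-1}\times 2^{m-1}$ matrices $S_m(u,v)$ and $\overline{S_m(u,v)}$ are defined by $S_1(u,v)=(u_1)$, $\overline{S_1(u,v)}=(v_1)$, and for $m\geq 2$, with $u'=(u_2,\dots,u_m)$, $v'=(v_2,\dots,v_m)$ and $I$ the identity matrix of size $2^{m-2}$, $$S_m(u,v)=\begin{pmatrix} u_1 I & S_{m-1}(u',v')\\ -S_{m-1}(v',u')^t & v_1 I\end{pmatrix},\qquad \overline{S_m(u,v)}=\begin{pmatrix} v_1 I & -S_{m-1}(u',v')\\ S_{m-1}(v',u')^t & u_1 I\end{pmatrix}.$$ For $p,f\in R^n$ and $a,b\in R$, $S_{n+1}(b,f,a,p)$ means $S_{n+1}(u,v)$ with $u=(b,f)=(b,f_1,\dots,f_n)$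 and $v=(a,p)=(a,p_1,\dots,p_n)$; similarly for $\overline{S_{n+1}(b,f,a,p)}$. Exterior algebra: for a finitely generated projective $R$-module $Q$, $\Lambda(Q)=\Lambda_0(Q)\oplus\Lambda_1(Q)$ with $\Lambda_0(Q)=\bigoplus_{i\ge0}\Lambda^{2i}(Q)$ and $\Lambda_1(Q)=\bigoplus_{i\ge0}\Lambda^{2i+1}(Q)$. The map $\Phi$: let $P$ be a finitely generated projective $R$-module (here $P=R^n$, so $P\oplus R=R^{n+1}$) and $x=(p,a,f,b)\in P\oplus R\oplus P^\vee\oplus R^\vee$. Put $x'=(p,a)\in P\oplus R$ and $x''=(f,b)\in (P\oplus R)^\vee$. Let $l_{x'}:\Lambda(P\oplus R)\to\Lambda(P\oplus R)$ be left multiplication $\omega\mapsto x'\wedge\omega$, and let $d_{x''}$ be given by $d_{x''}(y_1\wedge\dots\wedge y_r)=\sum_{i=1}^r(-1)^{i+1}x''(y_i)\,y_1\wedge\dots\wedge\widehat{y_i}\wedge\dots\wedge y_r$. Set $\Phi(x)=l_{x'}+d_{x''}$. It interchanges $\Lambda_0$ and $\Lambda_1$; $\Phi_{1,0}(x):\Lambda_1(P\oplus R)\to\Lambda_0(P\oplus R)$ and $\Phi_{0,1}(x):\Lambda_0(P\oplus R)\to\Lambda_1(P\oplus R)$ denote its restrictions. Generalized Suslin endomorphisms: let $x_0=(0,1,0,1)\in P\oplus R\oplus P^\vee\oplus R^\vee$. Define the endomorphisms of $\Lambda_1(P\oplus R)$ $$S(x)=\Phi_{0,1}(x_0)\circ\Phi_{1,0}(x),\qquad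 \overline{S(x)}=\Phi_{0,1}(x)\circ\Phi_{1,0}(x_0).$$ *)

theory Defs
  imports "Jordan_Normal_Form.Matrix" "HOL-Algebra.QuotRing" "HOL-Library.Poly_Mapping"
begin

section \<open>Suslin matrices\<close>

text \<open>
  The first argument is the length \<open>m \<ge> 1\<close> of the vectors \<open>u\<close> and \<open>v\<close>; the value for \<open>m = 0\<close> is
  irrelevant. In the recursive case \<open>m = k + 2\<close>, and \<open>vec_last u (Suc k)\<close> is \<open>(u\<^sub>2, \<dots>, u\<^sub>m)\<close>.
\<close>

fun suslin :: "nat \<Rightarrow> 'a::comm_ring_1 vec \<Rightarrow> 'a vec \<Rightarrow> 'a mat" where
  "suslin 0 u v = 1\<^sub>m 0"
| "suslin (Suc 0) u v = mat 1 1 (\<lambda>_. u $ 0)"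
| "suslin (Suc (Suc k)) u v =
     (let u' = vec_last u (Suc k); v' = vec_last v (Suc k) in
      four_block_mat
        (u $ 0 \<cdot>\<^sub>m 1\<^sub>m (2 ^ k))                      (suslin (Suc k) u' v')
        (- transpose_mat (suslin (Suc k) v' u'))   (v $ 0 \<cdot>\<^sub>m 1\<^sub>m (2 ^ k)))"

fun suslin_bar :: "nat \<Rightarrow> 'a::comm_ring_1 vec \<Rightarrow> 'a vec \<Rightarrow> 'a mat" where
  "suslin_bar 0 u v = 1\<^sub>m 0"
| "suslin_bar (Suc 0) u v = mat 1 1 (\<lambda>_. v $ 0)"
| "suslin_bar (Suc (Suc k)) u v =
     (let u' = vec_last u (Suc k); v' = vec_last v (Suc k) in
      four_block_mat
        (v $ 0 \<cdot>\<^sub>m 1\<^sub>m (2 ^ k))                      (- suslin (Suc k) u' v')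
        (transpose_mat (suslin (Suc k) v' u'))     (u $ 0 \<cdot>\<^sub>m 1\<^sub>m (2 ^ k)))"


section \<open>The exterior algebra of \<open>R\<^sup>m\<close>\<close>

text \<open>
  Words form a monoid under concatenation, so that \<open>'x list \<Rightarrow>\<^sub>0 'a\<close> with the convolution product
  is the free associative \<open>'a\<close>-algebra on \<open>'x\<close>.
\<close>

instantiation list :: (type) monoid_add
begin

definition zero_list :: "'a list" where "zero_list = []"
definition plus_list :: "'a list \<Rightarrow> 'a list \<Rightarrow> 'a list" where "plus_list = (@)"

instance by standard (simp_all add: zero_list_def plus_list_def)

end

definition free_algebra :: "'x set \<Rightarrow> ('x list \<Rightarrow>\<^sub>0 'a::comm_ring_1) ring" where
  "free_algebra X =
     \<lparr>carrier = {t. \<forall>w\<in>Poly_Mapping.keys t. set w \<subseteq> X}, mult = (*), one = 1, zero = 0, add = (+)\<rparr>"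

text \<open>
  \<open>\<Lambda>(R\<^sup>m)\<close> is the free algebra on the underlying set of \<open>R\<^sup>m\<close> modulo the relations which make the
  inclusion \<open>R\<^sup>m \<rightarrow> \<Lambda>(R\<^sup>m)\<close> linear (these alone give the tensor algebra) and the relations
  \<open>v \<and> v = 0\<close>. Below, \<open>Poly_Mapping.single [v\<^sub>1, \<dots>, v\<^sub>r] c\<close> stands for \<open>c v\<^sub>1 \<cdots> v\<^sub>r\<close>.
\<close>

definition exterior_relations :: "nat \<Rightarrow> ('a::comm_ring_1 vec list \<Rightarrow>\<^sub>0 'a) set" where
  "exterior_relations m =
     {Poly_Mapping.single [u + v] 1 - Poly_Mapping.single [u] 1 - Poly_Mapping.single [v] 1 | u v.
        u \<in> carrier_vec m \<and> v \<in> carrier_vec m}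
   \<union> {Poly_Mapping.single [r \<cdot>\<^sub>v v] 1 - Poly_Mapping.single [v] r | r v. v \<in> carrier_vec m}
   \<union> {Poly_Mapping.single [v, v] 1 | v. v \<in> carrier_vec m}"

definition exterior_ideal :: "nat \<Rightarrow> ('a::comm_ring_1 vec list \<Rightarrow>\<^sub>0 'a) set" where
  "exterior_ideal m = genideal (free_algebra (carrier_vec m)) (exterior_relations m)"

definition ext_class ::
  "nat \<Rightarrow> ('a::comm_ring_1 vec list \<Rightarrow>\<^sub>0 'a) \<Rightarrow> ('a vec list \<Rightarrow>\<^sub>0 'a) set" where
  "ext_class m t = exterior_ideal m +>\<^bsub>free_algebra (carrier_vec m)\<^esub> t"

definition exterior_algebra ::
  "nat \<Rightarrow> ('a::comm_ring_1, ('a vec list \<Rightarrow>\<^sub>0 'a) set) module" where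
  "exterior_algebra m =
     (let Q = free_algebra (carrier_vec m) Quot exterior_ideal m in
      ring.extend Q
        (module.fields (\<lambda>r X. ext_class m (Poly_Mapping.single [] r) \<otimes>\<^bsub>Q\<^esub> X)))"

text \<open>
  \<open>\<Lambda>\<^sub>0\<close> and \<open>\<Lambda>\<^sub>1\<close>: the sums of the \<open>\<Lambda>\<^sup>r\<close> for even, respectively odd, \<open>r\<close>, where \<open>\<Lambda>\<^sup>r\<close> is spanned
  by the products of \<open>r\<close> vectors.
\<close>

definition exterior_even :: "nat \<Rightarrow> ('a::comm_ring_1 vec list \<Rightarrow>\<^sub>0 'a) set set" where
  "exterior_even m =
     ext_class m ` {t \<in> carrier (free_algebra (carrier_vec m)).
                      \<forall>w\<in>Poly_Mapping.keys t. even (length w)}"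

definition exterior_odd :: "nat \<Rightarrow> ('a::comm_ring_1 vec list \<Rightarrow>\<^sub>0 'a) set set" where
  "exterior_odd m =
     ext_class m ` {t \<in> carrier (free_algebra (carrier_vec m)).
                      \<forall>w\<in>Poly_Mapping.keys t. odd (length w)}"

definition left_mult ::
  "nat \<Rightarrow> 'a::comm_ring_1 vec \<Rightarrow> ('a vec list \<Rightarrow>\<^sub>0 'a) set \<Rightarrow> ('a vec list \<Rightarrow>\<^sub>0 'a) set" where
  "left_mult m y X = ext_class m (Poly_Mapping.single [y] 1) \<otimes>\<^bsub>exterior_algebra m\<^esub> X"

text \<open>
  The contraction with a linear functional \<open>\<phi>\<close>, first on the free algebra (positions in words are
  counted from \<open>0\<close>, whence the sign \<open>(-1)\<^sup>i\<close>), then on the quotient. It maps the ideal into itself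
  (lemma \<open>contract_ideal\<close>), so the image in the definition of \<open>contraction\<close> is a singleton;
  lemma \<open>contraction_wedge\<close> gives the usual formula on \<open>y\<^sub>1 \<and> \<dots> \<and> y\<^sub>r\<close>.
\<close>

definition contract_word :: "('x \<Rightarrow> 'a::comm_ring_1) \<Rightarrow> 'x list \<Rightarrow> ('x list \<Rightarrow>\<^sub>0 'a)" where
  "contract_word \<phi> w =
     (\<Sum>i<length w. Poly_Mapping.single (take i w @ drop (Suc i) w) ((-1) ^ i * \<phi> (w ! i)))"

definition contract_free ::
  "('x \<Rightarrow> 'a::comm_ring_1) \<Rightarrow> ('x list \<Rightarrow>\<^sub>0 'a) \<Rightarrow> ('x list \<Rightarrow>\<^sub>0 'a)" where
  "contract_free \<phi> t =
     (\<Sum>w\<in>Poly_Mapping.keys t. Poly_Mapping.single [] (Poly_Mapping.lookup t w) * contract_word \<phi> w)"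

definition contraction ::
  "nat \<Rightarrow> ('a::comm_ring_1 vec \<Rightarrow> 'a) \<Rightarrow> ('a vec list \<Rightarrow>\<^sub>0 'a) set \<Rightarrow> ('a vec list \<Rightarrow>\<^sub>0 'a) set" where
  "contraction m \<phi> X = the_elem ((\<lambda>t. ext_class m (contract_free \<phi> t)) ` X)"

lemma keys_uminus: "Poly_Mapping.keys (- t) = Poly_Mapping.keys (t :: 'x \<Rightarrow>\<^sub>0 'a::ab_group_add)"
  by (auto simp: in_keys_iff)

lemma keys_minus_subset:
  "Poly_Mapping.keys (s - t) \<subseteq> Poly_Mapping.keys s \<union> Poly_Mapping.keys (t :: 'x \<Rightarrow>\<^sub>0 'a::ab_group_add)"
  by (auto simp: in_keys_iff lookup_minus)

lemma poly_mapping_eq_sum_single: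
  "(\<Sum>w\<in>Poly_Mapping.keys t. Poly_Mapping.single w (Poly_Mapping.lookup t w)) = t"
proof (rule poly_mapping_eqI)
  fix v
  show "Poly_Mapping.lookup (\<Sum>w\<in>Poly_Mapping.keys t. Poly_Mapping.single w (Poly_Mapping.lookup t w)) v =
      Poly_Mapping.lookup t v"
    by (cases "v \<in> Poly_Mapping.keys t")
       (auto simp: lookup_sum lookup_single when_def in_keys_iff)
qed

lemma ring_free_algebra: "ring (free_algebra X :: ('x list \<Rightarrow>\<^sub>0 'a::comm_ring_1) ring)"
proof (rule ringI)
  let ?R = "free_algebra X :: ('x list \<Rightarrow>\<^sub>0 'a) ring"
  have uminus: "- s \<in> carrier ?R" if "s \<in> carrier ?R" for s
    using that by (simp add: free_algebra_def keys_uminus)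
  have plus: "s + t \<in> carrier ?R" if "s \<in> carrier ?R" "t \<in> carrier ?R" for s t
    using that keys_add[of s t] by (fastforce simp: free_algebra_def)
  have mult: "s * t \<in> carrier ?R" if "s \<in> carrier ?R" "t \<in> carrier ?R" for s t
    using that keys_mult[of s t] by (fastforce simp: free_algebra_def plus_list_def)
  show "abelian_group ?R"
  proof (rule abelian_groupI)
    fix s assume s: "s \<in> carrier ?R"
    show "\<exists>t\<in>carrier ?R. t \<oplus>\<^bsub>?R\<^esub> s = \<zero>\<^bsub>?R\<^esub>"
      by (rule bexI[OF _ uminus[OF s]]) (simp add: free_algebra_def)
  next
    fix s t assume "s \<in> carrier ?R" "t \<in> carrier ?R"
    thus "s \<oplus>\<^bsub>?R\<^esub> t \<in> carrier ?R"
      using plus[of s t] by (simp add: free_algebra_def)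
  qed (simp_all add: free_algebra_def add_ac)
  show "Group.monoid ?R"
  proof (rule monoidI)
    fix s t assume "s \<in> carrier ?R" "t \<in> carrier ?R"
    thus "s \<otimes>\<^bsub>?R\<^esub> t \<in> carrier ?R"
      using mult[of s t] by (simp add: free_algebra_def)
  qed (simp_all add: free_algebra_def mult.assoc zero_list_def)
qed (simp_all add: free_algebra_def distrib_left distrib_right)

lemma exterior_relations_carrier:
  "exterior_relations m \<subseteq> carrier (free_algebra (carrier_vec m) :: ('a::comm_ring_1 vec list \<Rightarrow>\<^sub>0 'a) ring)"
proof -
  have 1: "Poly_Mapping.single w c \<in> carrier (free_algebra (carrier_vec m))"
    if "set w \<subseteq> carrier_vec m" for w :: "'a vec list" and c :: 'a
    using that by (simp add: free_algebra_def)
  have 2: "s - t \<in> carrier (free_algebra (carrier_vec m))"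
    if "s \<in> carrier (free_algebra (carrier_vec m))" "t \<in> carrier (free_algebra (carrier_vec m))"
    for s t :: "'a vec list \<Rightarrow>\<^sub>0 'a"
    using that keys_minus_subset[of s t] by (fastforce simp: free_algebra_def)
  show ?thesis
    unfolding exterior_relations_def by (auto intro!: 1 2)
qed

lemma ideal_exterior_ideal: "ideal (exterior_ideal m) (free_algebra (carrier_vec m))"
  unfolding exterior_ideal_def
  by (rule ring.genideal_ideal[OF ring_free_algebra exterior_relations_carrier])

lemma contract_free_superset:
  assumes "finite K" "Poly_Mapping.keys t \<subseteq> K"
  shows "contract_free \<phi> t =
     (\<Sum>w\<in>K. Poly_Mapping.single [] (Poly_Mapping.lookup t w) * contract_word \<phi> w)"
  unfolding contract_free_def
  by (rule sum.mono_neutral_left) (use assms in \<open>auto simp: in_keys_iff\<close>)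

lemma contract_free_add: "contract_free \<phi> (s + t) = contract_free \<phi> s + contract_free \<phi> t"
proof -
  let ?K = "Poly_Mapping.keys s \<union> Poly_Mapping.keys t"
  show ?thesis
    using keys_add[of s t]
    by (simp add: contract_free_superset[of ?K] lookup_add single_add distrib_right sum.distrib)
qed

lemma contract_free_0 [simp]: "contract_free \<phi> 0 = 0"
  by (simp add: contract_free_def)

lemma contract_free_uminus: "contract_free \<phi> (- t) = - contract_free \<phi> t"
  using contract_free_add[of \<phi> t "- t"] by (simp add: eq_neg_iff_add_eq_0 add.commute)

lemma contract_free_diff: "contract_free \<phi> (s - t) = contract_free \<phi> s - contract_free \<phi> t"
  using contract_free_add[of \<phi> s "- t"] by (simp add: contract_free_uminus)

lemma contract_free_single:
  "contract_free \<phi> (Poly_Mapping.single w c) = Poly_Mapping.single [] c * contract_word \<phi> w"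
  by (subst contract_free_superset[of "{w}"]) auto

text \<open>The grading involution, with respect to which \<open>contract_free \<phi>\<close> is an antiderivation.\<close>

definition grade_inv :: "('x list \<Rightarrow>\<^sub>0 'a::comm_ring_1) \<Rightarrow> ('x list \<Rightarrow>\<^sub>0 'a)" where
  "grade_inv t =
     (\<Sum>w\<in>Poly_Mapping.keys t. Poly_Mapping.single w ((-1) ^ length w * Poly_Mapping.lookup t w))"

lemma grade_inv_superset:
  assumes "finite K" "Poly_Mapping.keys t \<subseteq> K"
  shows "grade_inv t =
     (\<Sum>w\<in>K. Poly_Mapping.single w ((-1) ^ length w * Poly_Mapping.lookup t w))"
  unfolding grade_inv_def
  by (rule sum.mono_neutral_left) (use assms in \<open>auto simp: in_keys_iff\<close>)

lemma grade_inv_add: "grade_inv (s + t) = grade_inv s + grade_inv t"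
proof -
  let ?K = "Poly_Mapping.keys s \<union> Poly_Mapping.keys t"
  show ?thesis
    using keys_add[of s t]
    by (simp add: grade_inv_superset[of ?K] lookup_add single_add distrib_left sum.distrib)
qed

lemma grade_inv_0 [simp]: "grade_inv 0 = 0"
  by (simp add: grade_inv_def)

lemma grade_inv_uminus: "grade_inv (- t) = - grade_inv t"
  using grade_inv_add[of t "- t"] by (simp add: eq_neg_iff_add_eq_0 add.commute)

lemma grade_inv_diff: "grade_inv (s - t) = grade_inv s - grade_inv t"
  using grade_inv_add[of s "- t"] by (simp add: grade_inv_uminus)

lemma grade_inv_single:
  "grade_inv (Poly_Mapping.single w c) = Poly_Mapping.single w ((-1) ^ length w * c)"
  by (subst grade_inv_superset[of "{w}"]) auto

lemma poly_mapping_additive_induct [case_names single add]: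
  fixes t :: "'x \<Rightarrow>\<^sub>0 'a::comm_monoid_add"
  assumes "\<And>w c. P (Poly_Mapping.single w c)" "\<And>s t. P s \<Longrightarrow> P t \<Longrightarrow> P (s + t)"
  shows "P t"
proof -
  have "P 0"
    using assms(1)[of undefined 0] by simp
  hence "P (\<Sum>w\<in>Poly_Mapping.keys t. Poly_Mapping.single w (Poly_Mapping.lookup t w))"
    by (induction rule: infinite_finite_induct) (auto intro: assms)
  thus ?thesis
    by (simp add: poly_mapping_eq_sum_single)
qed

lemma grade_inv_mult: "grade_inv (s * t) = grade_inv s * grade_inv t"
proof (induction s rule: poly_mapping_additive_induct)
  case (single w c)
  show ?case
    by (induction t rule: poly_mapping_additive_induct)
       (simp_all add: grade_inv_single grade_inv_add mult_single plus_list_def power_add mult_ac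
          distrib_left)
qed (simp add: grade_inv_add distrib_right)

lemma sum_lessThan_add: "(\<Sum>i<m + k. g i) = (\<Sum>i<m. g i) + (\<Sum>i<k. g (m + i))"
  for g :: "nat \<Rightarrow> 'b::comm_monoid_add"
  by (induction k) (simp_all add: add.assoc)

lemma contract_word_append:
  fixes \<phi> :: "'x \<Rightarrow> 'a::comm_ring_1"
  shows "contract_word \<phi> (v @ w) =
     contract_word \<phi> v * Poly_Mapping.single w 1 +
     Poly_Mapping.single v ((-1) ^ length v) * contract_word \<phi> w"
proof -
  let ?g = "\<lambda>i. Poly_Mapping.single (take i (v @ w) @ drop (Suc i) (v @ w)) ((-1) ^ i * \<phi> ((v @ w) ! i))"
  have "contract_word \<phi> (v @ w) = (\<Sum>i<length v + length w. ?g i)"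
    by (simp add: contract_word_def)
  also have "\<dots> = (\<Sum>i<length v. ?g i) + (\<Sum>i<length w. ?g (length v + i))"
    by (rule sum_lessThan_add)
  also have "(\<Sum>i<length v. ?g i) = contract_word \<phi> v * Poly_Mapping.single w 1"
    unfolding contract_word_def sum_distrib_right
    by (rule sum.cong) (simp_all add: mult_single plus_list_def nth_append)
  also have "(\<Sum>i<length w. ?g (length v + i)) =
      Poly_Mapping.single v ((-1) ^ length v) * contract_word \<phi> w"
    unfolding contract_word_def sum_distrib_left
    by (rule sum.cong) (simp_all add: mult_single plus_list_def nth_append power_add mult_ac)
  finally show ?thesis .
qed

lemma single_Nil_mult_commute:
  "Poly_Mapping.single [] (c :: 'a::comm_ring_1) * t = t * Poly_Mapping.single [] c"
  by (induction t rule: poly_mapping_additive_induct)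
     (simp_all add: mult_single plus_list_def mult.commute distrib_left distrib_right)

lemma single_Nil_mult: 
  "Poly_Mapping.single [] (c :: 'a::comm_ring_1) * Poly_Mapping.single w d = Poly_Mapping.single w (c * d)"
  by (simp add: mult_single plus_list_def)

lemma single_Nil_mult_left_commute:
  "Poly_Mapping.single [] (c :: 'a::comm_ring_1) * (s * t) = s * (Poly_Mapping.single [] c * t)"
  by (metis mult.assoc single_Nil_mult_commute)

lemma contract_free_mult:
  "contract_free \<phi> (s * t) = contract_free \<phi> s * t + grade_inv s * contract_free \<phi> t"
proof (induction s rule: poly_mapping_additive_induct)
  case (single v c)
  show ?case
  proof (induction t rule: poly_mapping_additive_induct)
    case (single w d)
    let ?c = "Poly_Mapping.single [] c" and ?d = "Poly_Mapping.single [] d"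
    let ?w = "Poly_Mapping.single w 1"
    have *: "Poly_Mapping.single [] (c * d) = ?c * ?d"
      by (simp add: single_Nil_mult)
    have 1: "Poly_Mapping.single [] (c * d) * (contract_word \<phi> v * ?w) =
        ?c * contract_word \<phi> v * Poly_Mapping.single w d"
    proof -
      have "Poly_Mapping.single w d = ?d * ?w"
        by (simp add: single_Nil_mult)
      thus ?thesis
        by (simp only: * mult.assoc single_Nil_mult_left_commute[of d "contract_word \<phi> v" ?w])
    qed
    have 2: "Poly_Mapping.single [] (c * d) *
          (Poly_Mapping.single v ((-1) ^ length v) * contract_word \<phi> w) =
        Poly_Mapping.single v ((-1) ^ length v * c) * (?d * contract_word \<phi> w)"
    proof -
      have "Poly_Mapping.single v ((-1) ^ length v * c) = ?c * Poly_Mapping.single v ((-1) ^ length v)"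
        by (simp add: single_Nil_mult mult.commute)
      thus ?thesis
        by (simp only: * mult.assoc
            single_Nil_mult_left_commute[of d "Poly_Mapping.single v ((-1) ^ length v)"])
    qed
    show ?case
      using 1 2
      by (simp add: mult_single plus_list_def contract_free_single grade_inv_single
            contract_word_append distrib_left)
  qed (simp add: contract_free_add distrib_left)
qed (simp add: contract_free_add grade_inv_add distrib_right)

lemma contract_free_closed:
  fixes t :: "'x list \<Rightarrow>\<^sub>0 'a::comm_ring_1"
  assumes "t \<in> carrier (free_algebra X)"
  shows "contract_free \<phi> t \<in> carrier (free_algebra X)"
proof -
  interpret ring "free_algebra X :: ('x list \<Rightarrow>\<^sub>0 'a) ring"
    by (rule ring_free_algebra)
  have sum: "(\<Sum>i\<in>I. h i) \<in> carrier (free_algebra X)"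
    if "\<And>i. i \<in> I \<Longrightarrow> h i \<in> carrier (free_algebra X)" for I :: "'i set" and h :: "'i \<Rightarrow> 'x list \<Rightarrow>\<^sub>0 'a"
    using that
  proof (induction I rule: infinite_finite_induct)
    case (insert i I)
    have "h i \<oplus>\<^bsub>free_algebra X\<^esub> (\<Sum>i\<in>I. h i) \<in> carrier (free_algebra X)"
      by (rule a_closed) (use insert in blast)+
    with insert.hyps show ?case
      by (simp add: free_algebra_def)
  qed (simp_all add: free_algebra_def)
  have "contract_word \<phi> w \<in> carrier (free_algebra X)" if "set w \<subseteq> X" for w
    unfolding contract_word_def
    by (rule sum) (use that set_take_subset[of _ w] set_drop_subset[of _ w] in
        \<open>auto simp: free_algebra_def dest!: in_set_takeD in_set_dropD\<close>)
  moreover have "Poly_Mapping.single [] c \<in> carrier (free_algebra X)" for c :: 'a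
    by (simp add: free_algebra_def)
  ultimately have "Poly_Mapping.single [] c * contract_word \<phi> w \<in> carrier (free_algebra X)"
    if "set w \<subseteq> X" for c w
    using m_closed[of "Poly_Mapping.single [] c" "contract_word \<phi> w"] that
    by (simp add: free_algebra_def)
  thus ?thesis
    unfolding contract_free_def by (intro sum) (use assms in \<open>auto simp: free_algebra_def\<close>)
qed

lemma grade_inv_closed:
  assumes "t \<in> carrier (free_algebra X)"
  shows "grade_inv t \<in> carrier (free_algebra X)"
proof -
  have "Poly_Mapping.lookup (grade_inv t) w = 0" if "Poly_Mapping.lookup t w = 0" for w
    using that by (auto simp: grade_inv_def lookup_sum lookup_single when_def intro!: sum.neutral)
  hence "Poly_Mapping.keys (grade_inv t) \<subseteq> Poly_Mapping.keys t"
    by (auto simp: in_keys_iff)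
  thus ?thesis
    using assms by (auto simp: free_algebra_def)
qed

lemma contract_ideal:
  fixes \<phi> :: "'a::comm_ring_1 vec \<Rightarrow> 'a"
  assumes add: "\<And>u v. u \<in> carrier_vec m \<Longrightarrow> v \<in> carrier_vec m \<Longrightarrow> \<phi> (u + v) = \<phi> u + \<phi> v"
    and smult: "\<And>r v. v \<in> carrier_vec m \<Longrightarrow> \<phi> (r \<cdot>\<^sub>v v) = r * \<phi> v"
    and t: "t \<in> exterior_ideal m"
  shows "contract_free \<phi> t \<in> exterior_ideal m"
proof -
  let ?R = "free_algebra (carrier_vec m) :: ('a vec list \<Rightarrow>\<^sub>0 'a) ring"
  let ?I = "exterior_ideal m :: ('a vec list \<Rightarrow>\<^sub>0 'a) set"
  interpret I: ideal ?I ?R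
    by (rule ideal_exterior_ideal)
  have ops [simp]: "x \<oplus>\<^bsub>?R\<^esub> y = x + y" "x \<otimes>\<^bsub>?R\<^esub> y = x * y" "\<zero>\<^bsub>?R\<^esub> = 0" for x y
    by (simp_all add: free_algebra_def)
  have plus: "x + y \<in> ?I" if "x \<in> ?I" "y \<in> ?I" for x y
    using additive_subgroup.a_closed[OF I.additive_subgroup_axioms that] by simp
  have lmult: "x * y \<in> ?I" if "x \<in> carrier ?R" "y \<in> ?I" for x y
    using I.I_l_closed[OF that(2,1)] by simp
  have rmult: "x * y \<in> ?I" if "x \<in> ?I" "y \<in> carrier ?R" for x y
    using I.I_r_closed[OF that] by simp
  have uminus: "- x \<in> ?I" if "x \<in> ?I" for x
    using lmult[of "- 1" x] that by (simp add: free_algebra_def keys_uminus zero_list_def)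
  have inv: "\<ominus>\<^bsub>?R\<^esub> x = - x" if "x \<in> carrier ?R" for x
  proof (rule I.minus_equality)
    show "- x \<in> carrier ?R"
      using that by (simp add: free_algebra_def keys_uminus)
  qed (use that in simp_all)
  have sub: "x \<in> carrier ?R" if "x \<in> ?I" for x
    using I.a_subset that by auto
  define J where "J = {t \<in> ?I. contract_free \<phi> t \<in> ?I \<and> grade_inv t \<in> ?I}"
  have "ideal J ?R"
  proof (rule idealI[OF ring_free_algebra])
    show "subgroup J (add_monoid ?R)"
    proof (rule group.subgroupI)
      show "Group.group (add_monoid ?R)"
        by (rule I.add.is_group)
    next
      show "J \<subseteq> carrier (add_monoid ?R)"
        using sub by (auto simp: J_def)
    next
      have "0 \<in> J"
        using additive_subgroup.zero_closed[OF I.additive_subgroup_axioms] by (simp add: J_def)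
      thus "J \<noteq> {}" by auto
    next
      fix x assume "x \<in> J"
      moreover from this have "inv\<^bsub>add_monoid ?R\<^esub> x = - x"
        using inv[of x] sub by (auto simp: J_def a_inv_def)
      ultimately show "inv\<^bsub>add_monoid ?R\<^esub> x \<in> J"
        by (auto simp: J_def uminus contract_free_uminus grade_inv_uminus)
    next
      fix x y assume "x \<in> J" "y \<in> J"
      thus "x \<otimes>\<^bsub>add_monoid ?R\<^esub> y \<in> J"
        by (auto simp: J_def plus contract_free_add grade_inv_add)
    qed
  next
    fix a x assume "a \<in> J" "x \<in> carrier ?R"
    thus "x \<otimes>\<^bsub>?R\<^esub> a \<in> J" "a \<otimes>\<^bsub>?R\<^esub> x \<in> J"
      by (auto simp: J_def contract_free_mult grade_inv_mult
          intro: plus lmult rmult contract_free_closed grade_inv_closed)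
  qed
  moreover have "exterior_relations m \<subseteq> J"
  proof
    fix x :: "'a vec list \<Rightarrow>\<^sub>0 'a" assume x: "x \<in> exterior_relations m"
    have xI: "x \<in> ?I"
      using x ring.genideal_self[OF ring_free_algebra exterior_relations_carrier, where m1 = m]
      by (auto simp: exterior_ideal_def)
    moreover have "contract_free \<phi> x = 0"
      using x unfolding exterior_relations_def
    proof (elim UnE CollectE exE conjE)
      fix u v assume "x = Poly_Mapping.single [u + v] 1 - Poly_Mapping.single [u] 1 - Poly_Mapping.single [v] 1"
        and "u \<in> carrier_vec m" "v \<in> carrier_vec m"
      thus ?thesis
        by (simp add: contract_free_diff contract_free_single contract_word_def add single_add
            single_Nil_mult distrib_left)
    next
      fix r v assume "x = Poly_Mapping.single [r \<cdot>\<^sub>v v] 1 - Poly_Mapping.single [v] r" "v \<in> carrier_vec m"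
      thus ?thesis
        by (simp add: contract_free_diff contract_free_single contract_word_def smult
            single_Nil_mult)
    next
      fix v assume "x = Poly_Mapping.single [v, v] 1"
      thus ?thesis
        by (simp add: contract_free_single contract_word_def single_uminus)
    qed
    moreover have "grade_inv x = x \<or> grade_inv x = - x"
      using x by (auto simp: exterior_relations_def grade_inv_diff grade_inv_single single_uminus)
    ultimately show "x \<in> J"
      using uminus[OF xI] additive_subgroup.zero_closed[OF I.additive_subgroup_axioms] by (auto simp: J_def)
  qed
  ultimately have "?I \<subseteq> J"
    unfolding exterior_ideal_def by (rule ring.genideal_minimal[OF ring_free_algebra])
  thus ?thesis
    using t by (auto simp: J_def)
qed

lemma contraction_class:
  fixes \<phi> :: "'a::comm_ring_1 vec \<Rightarrow> 'a"
  assumes \<phi>: "\<And>u v. u \<in> carrier_vec m \<Longrightarrow> v \<in> carrier_vec m \<Longrightarrow> \<phi> (u + v) = \<phi> u + \<phi> v"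
      "\<And>r v. v \<in> carrier_vec m \<Longrightarrow> \<phi> (r \<cdot>\<^sub>v v) = r * \<phi> v"
    and t: "t \<in> carrier (free_algebra (carrier_vec m))"
  shows "contraction m \<phi> (ext_class m t) = ext_class m (contract_free \<phi> t)"
proof -
  let ?R = "free_algebra (carrier_vec m) :: ('a vec list \<Rightarrow>\<^sub>0 'a) ring"
  interpret I: ideal "exterior_ideal m" ?R
    by (rule ideal_exterior_ideal)
  have add: "x \<oplus>\<^bsub>?R\<^esub> y = x + y" for x y
    by (simp add: free_algebra_def)
  have "ext_class m (contract_free \<phi> s) = ext_class m (contract_free \<phi> t)" if "s \<in> ext_class m t" for s
  proof -
    from that obtain i where i: "i \<in> exterior_ideal m" "s = i + t"
      by (auto simp: ext_class_def a_r_coset_def' add)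
    hence "contract_free \<phi> s \<in> ext_class m (contract_free \<phi> t)"
      using contract_ideal[OF \<phi> i(1)]
      by (auto simp: ext_class_def a_r_coset_def' add contract_free_add)
    thus ?thesis
      unfolding ext_class_def
      by (rule I.a_repr_independence'[OF _ contract_free_closed[OF t], symmetric])
  qed
  moreover have "t \<in> ext_class m t"
    unfolding ext_class_def by (rule I.a_rcos_self[OF t])
  ultimately have "(\<lambda>s. ext_class m (contract_free \<phi> s)) ` ext_class m t =
      {ext_class m (contract_free \<phi> t)}"
    by blast
  thus ?thesis
    by (simp add: contraction_def)
qed

lemma contraction_wedge:
  fixes \<phi> :: "'a::comm_ring_1 vec \<Rightarrow> 'a"
  assumes "\<And>u v. u \<in> carrier_vec m \<Longrightarrow> v \<in> carrier_vec m \<Longrightarrow> \<phi> (u + v) = \<phi> u + \<phi> v"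
    and "\<And>r v. v \<in> carrier_vec m \<Longrightarrow> \<phi> (r \<cdot>\<^sub>v v) = r * \<phi> v"
    and "set ys \<subseteq> carrier_vec m"
  shows "contraction m \<phi> (ext_class m (Poly_Mapping.single ys 1)) =
     ext_class m (\<Sum>i<length ys.
       Poly_Mapping.single (take i ys @ drop (Suc i) ys) ((-1) ^ i * \<phi> (ys ! i)))"
proof -
  have "Poly_Mapping.single ys 1 \<in> carrier (free_algebra (carrier_vec m))"
    using assms(3) by (simp add: free_algebra_def)
  from contraction_class[OF assms(1,2) this] show ?thesis
    by (simp add: contract_free_single contract_word_def sum_distrib_left single_Nil_mult)
qed


section \<open>Generalized Suslin endomorphisms\<close>

text \<open>
  Here \<open>P = R\<^sup>n\<close> and \<open>P \<oplus> R = R\<^sup>n\<^sup>+\<^sup>1\<close>, with the summand \<open>R\<close> as the last coordinate. The functional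
  \<open>x'' = (f, b)\<close> is evaluated by means of the dual basis, i.e. by the scalar product.
\<close>

definition Phi ::
  "nat \<Rightarrow> 'a::comm_ring_1 vec \<times> 'a \<times> 'a vec \<times> 'a \<Rightarrow>
   ('a vec list \<Rightarrow>\<^sub>0 'a) set \<Rightarrow> ('a vec list \<Rightarrow>\<^sub>0 'a) set" where
  "Phi n x X =
     (case x of (p, a, f, b) \<Rightarrow>
        left_mult (n + 1) (p @\<^sub>v vec 1 (\<lambda>_. a)) X
          \<oplus>\<^bsub>exterior_algebra (n + 1)\<^esub>
        contraction (n + 1) (\<lambda>y. (f @\<^sub>v vec 1 (\<lambda>_. b)) \<bullet> y) X)"

definition Phi10 ::
  "nat \<Rightarrow> 'a::comm_ring_1 vec \<times> 'a \<times> 'a vec \<times> 'a \<Rightarrow>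
   ('a vec list \<Rightarrow>\<^sub>0 'a) set \<Rightarrow> ('a vec list \<Rightarrow>\<^sub>0 'a) set" where
  "Phi10 n x = restrict (Phi n x) (exterior_odd (n + 1))"

definition Phi01 ::
  "nat \<Rightarrow> 'a::comm_ring_1 vec \<times> 'a \<times> 'a vec \<times> 'a \<Rightarrow>
   ('a vec list \<Rightarrow>\<^sub>0 'a) set \<Rightarrow> ('a vec list \<Rightarrow>\<^sub>0 'a) set" where
  "Phi01 n x = restrict (Phi n x) (exterior_even (n + 1))"

definition base_point :: "nat \<Rightarrow> 'a::comm_ring_1 vec \<times> 'a \<times> 'a vec \<times> 'a" where
  "base_point n = (0\<^sub>v n, 1, 0\<^sub>v n, 1)"

definition suslin_endo ::
  "nat \<Rightarrow> 'a::comm_ring_1 vec \<times> 'a \<times> 'a vec \<times> 'a \<Rightarrow>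
   ('a vec list \<Rightarrow>\<^sub>0 'a) set \<Rightarrow> ('a vec list \<Rightarrow>\<^sub>0 'a) set" where
  "suslin_endo n x = compose (exterior_odd (n + 1)) (Phi01 n (base_point n)) (Phi10 n x)"

definition suslin_endo_bar ::
  "nat \<Rightarrow> 'a::comm_ring_1 vec \<times> 'a \<times> 'a vec \<times> 'a \<Rightarrow>
   ('a vec list \<Rightarrow>\<^sub>0 'a) set \<Rightarrow> ('a vec list \<Rightarrow>\<^sub>0 'a) set" where
  "suslin_endo_bar n x = compose (exterior_odd (n + 1)) (Phi01 n x) (Phi10 n (base_point n))"


section \<open>Ordered bases and representing matrices\<close>

definition list_lincomb :: "('a, 'm, 'z) module_scheme \<Rightarrow> 'm list \<Rightarrow> 'a vec \<Rightarrow> 'm" where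
  "list_lincomb M B c = (\<Oplus>\<^bsub>M\<^esub>i\<in>{..<length B}. (c $ i) \<odot>\<^bsub>M\<^esub> (B ! i))"

text \<open>\<open>B\<close> is an ordered basis of the submodule \<open>N\<close> of \<open>M\<close>.\<close>

definition ordered_basis ::
  "('a::comm_ring_1, 'm, 'z) module_scheme \<Rightarrow> 'm set \<Rightarrow> 'm list \<Rightarrow> bool" where
  "ordered_basis M N B \<longleftrightarrow>
     set B \<subseteq> N \<and>
     (\<forall>y\<in>N. \<exists>c\<in>carrier_vec (length B). y = list_lincomb M B c) \<and>
     (\<forall>c\<in>carrier_vec (length B). list_lincomb M B c = \<zero>\<^bsub>M\<^esub> \<longrightarrow> c = 0\<^sub>v (length B))"

text \<open>
  \<open>A\<close> represents \<open>h\<close> with respect to \<open>B\<close> if it sends the coordinates of \<open>y\<close> to those of \<open>h y\<close>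
  (coordinates are column vectors). In particular, column \<open>j\<close> of \<open>A\<close> consists of the coordinates
  of \<open>h (B ! j)\<close>, and \<open>h\<close> is linear.
\<close>

definition represents ::
  "('a::comm_ring_1, 'm, 'z) module_scheme \<Rightarrow> 'm list \<Rightarrow> ('m \<Rightarrow> 'm) \<Rightarrow> 'a mat \<Rightarrow> bool" where
  "represents M B h A \<longleftrightarrow>
     A \<in> carrier_mat (length B) (length B) \<and>
     (\<forall>c\<in>carrier_vec (length B).
        h (list_lincomb M B c) = list_lincomb M B (A *\<^sub>v c))"

end

theory Submission
  imports Defs
begin

text \<open>
  Put the last basis vector \<open>e\<close> of \<open>R\<^sup>n\<^sup>+\<^sup>1\<close> first, followed by \<open>e\<^sub>1, \<dots>, e\<^sub>n\<close>. Splitting off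
  the first vector \<open>x\<close> of the list, with \<open>\<Lambda>'\<close> the exterior algebra on the remaining ones,
  \<open>\<Lambda>\<^sub>1 = x \<and> \<Lambda>'\<^sub>0 \<oplus> \<Lambda>'\<^sub>1\<close> and \<open>\<Lambda>\<^sub>0 = \<Lambda>'\<^sub>0 \<oplus> x \<and> \<Lambda>'\<^sub>1\<close>. Bases chosen recursively along these
  decompositions turn \<open>\<Phi>\<^sub>1\<^sub>,\<^sub>0\<close> and \<open>\<Phi>\<^sub>0\<^sub>,\<^sub>1\<close> into the two Suslin matrices, and \<open>\<Phi>(x\<^sub>0)\<close> into
  the identity matrix.

  With the functional \<open>0\<close> this computation says that multiplication by a vector preserves the span of
  the basis words, whence they generate. Contracting with the functional dual to \<open>x\<close> separates the two
  summands, whence they are linearly independent; in degree \<open>0\<close> one uses that the coefficient of the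
  empty word vanishes on the ideal.
\<close>

section \<open>Calculations modulo the exterior ideal\<close>

lemma free_algebra_ops [simp]:
  "mult (free_algebra X) = (*)" "one (free_algebra X) = 1" "zero (free_algebra X) = 0"
  "add (free_algebra X) = (+)"
  by (simp_all add: free_algebra_def)

lemma single_in_free_algebra [simp, intro]:
  "set w \<subseteq> X \<Longrightarrow> Poly_Mapping.single w c \<in> carrier (free_algebra X)"
  by (simp add: free_algebra_def)

lemma free_algebra_add [simp, intro]:
  "s \<in> carrier (free_algebra X) \<Longrightarrow> t \<in> carrier (free_algebra X) \<Longrightarrow> s + t \<in> carrier (free_algebra X)"
  using ring.ring_simprules(1)[OF ring_free_algebra, of s X t] by simp

lemma free_algebra_mult [simp, intro]:
  "s \<in> carrier (free_algebra X) \<Longrightarrow> t \<in> carrier (free_algebra X) \<Longrightarrow> s * t \<in> carrier (free_algebra X)"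
  using ring.ring_simprules(5)[OF ring_free_algebra, of s X t] by simp

lemma free_algebra_zero [simp, intro]: "0 \<in> carrier (free_algebra X)"
  by (simp add: free_algebra_def)

lemma free_algebra_uminus [simp, intro]:
  "s \<in> carrier (free_algebra X) \<Longrightarrow> - s \<in> carrier (free_algebra X)"
  by (simp add: free_algebra_def keys_uminus)

lemma free_algebra_sum:
  "(\<And>i. i \<in> A \<Longrightarrow> h i \<in> carrier (free_algebra X)) \<Longrightarrow> sum h A \<in> carrier (free_algebra X)"
  by (induction A rule: infinite_finite_induct) auto

lemma exterior_ideal_zero [simp, intro]: "0 \<in> exterior_ideal m"
  using additive_subgroup.zero_closed[OF ideal.axioms(1)[OF ideal_exterior_ideal]] by simp

lemma exterior_ideal_add:
  "s \<in> exterior_ideal m \<Longrightarrow> t \<in> exterior_ideal m \<Longrightarrow> s + t \<in> exterior_ideal m"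
  using additive_subgroup.a_closed[OF ideal.axioms(1)[OF ideal_exterior_ideal], of s m t] by simp

lemma exterior_ideal_lmult:
  "s \<in> carrier (free_algebra (carrier_vec m)) \<Longrightarrow> t \<in> exterior_ideal m \<Longrightarrow> s * t \<in> exterior_ideal m"
  using ideal.I_l_closed[OF ideal_exterior_ideal, of t m s] by simp

lemma exterior_ideal_rmult:
  "s \<in> exterior_ideal m \<Longrightarrow> t \<in> carrier (free_algebra (carrier_vec m)) \<Longrightarrow> s * t \<in> exterior_ideal m"
  using ideal.I_r_closed[OF ideal_exterior_ideal, of s m t] by simp

lemma exterior_ideal_uminus: "s \<in> exterior_ideal m \<Longrightarrow> - s \<in> exterior_ideal m"
  using exterior_ideal_lmult[of "- 1" m s] by (simp add: free_algebra_def keys_uminus zero_list_def)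

lemma exterior_ideal_diff:
  "s \<in> exterior_ideal m \<Longrightarrow> t \<in> exterior_ideal m \<Longrightarrow> s - t \<in> exterior_ideal m"
  using exterior_ideal_add[of s m "- t"] exterior_ideal_uminus[of t m] by simp

lemma exterior_ideal_sum:
  "(\<And>i. i \<in> A \<Longrightarrow> h i \<in> exterior_ideal m) \<Longrightarrow> sum h A \<in> exterior_ideal m"
  by (induction A rule: infinite_finite_induct) (auto intro: exterior_ideal_add)

lemma exterior_relations_subset_ideal: "exterior_relations m \<subseteq> exterior_ideal m"
  unfolding exterior_ideal_def
  by (rule ring.genideal_self[OF ring_free_algebra exterior_relations_carrier])

lemma single_add_in_ideal:
  assumes "u \<in> carrier_vec m" "v \<in> carrier_vec m"
  shows "Poly_Mapping.single [u + v] 1 - Poly_Mapping.single [u] 1 - Poly_Mapping.single [v] 1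
    \<in> exterior_ideal m"
  using exterior_relations_subset_ideal[of m] assms unfolding exterior_relations_def by blast

lemma single_smult_in_ideal:
  assumes "v \<in> carrier_vec m"
  shows "Poly_Mapping.single [r \<cdot>\<^sub>v v] 1 - Poly_Mapping.single [v] r \<in> exterior_ideal m"
  using exterior_relations_subset_ideal[of m] assms unfolding exterior_relations_def by blast

lemma single_square_in_ideal:
  assumes "v \<in> carrier_vec m"
  shows "Poly_Mapping.single [v, v] 1 \<in> exterior_ideal m"
  using exterior_relations_subset_ideal[of m] assms unfolding exterior_relations_def by blast

text \<open>Polarisation of the relation for squares. In the free algebra the letter
  \<open>[u + v]\<close> is only congruent to the sum of \<open>[u]\<close> and \<open>[v]\<close>,
  so the expansion of its square needs two correction terms; the coefficient r enters through a
  final multiplication by a scalar.\<close>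

lemma single_anticommute_in_ideal:
  fixes u v :: "'a::comm_ring_1 vec"
  assumes u: "u \<in> carrier_vec m" and v: "v \<in> carrier_vec m"
  shows "Poly_Mapping.single [u, v] r + Poly_Mapping.single [v, u] r \<in> exterior_ideal m"
proof -
  let ?u = "Poly_Mapping.single [u] (1::'a)" and ?v = "Poly_Mapping.single [v] (1::'a)"
  let ?w = "Poly_Mapping.single [u + v] (1::'a)" and ?r = "Poly_Mapping.single [] r"
  have w: "u + v \<in> carrier_vec m"
    using u v by simp
  have "?u * ?u \<in> exterior_ideal m" "?v * ?v \<in> exterior_ideal m" "?w * ?w \<in> exterior_ideal m"
    using single_square_in_ideal[OF u] single_square_in_ideal[OF v] single_square_in_ideal[OF w]
    by (simp_all add: mult_single plus_list_def)
  moreover have "?w * (?w - ?u - ?v) \<in> exterior_ideal m"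
    "(?w - ?u - ?v) * (?u + ?v) \<in> exterior_ideal m"
    using u v w
    by (auto intro!: exterior_ideal_lmult[OF _ single_add_in_ideal]
        exterior_ideal_rmult[OF single_add_in_ideal])
  ultimately have "?w * ?w - ?w * (?w - ?u - ?v) - (?w - ?u - ?v) * (?u + ?v) - ?u * ?u - ?v * ?v
      \<in> exterior_ideal m"
    by (intro exterior_ideal_diff)
  also have "?w * ?w - ?w * (?w - ?u - ?v) - (?w - ?u - ?v) * (?u + ?v) - ?u * ?u - ?v * ?v
      = ?u * ?v + ?v * ?u"
    by (simp add: algebra_simps)
  finally have "?r * (?u * ?v + ?v * ?u) \<in> exterior_ideal m"
    by (intro exterior_ideal_lmult) auto
  thus ?thesis
    by (simp add: distrib_left mult_single plus_list_def)
qed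

section \<open>The constant term\<close>

lemma lookup_Nil_mult:
  "Poly_Mapping.lookup (s * t) [] = Poly_Mapping.lookup s [] * Poly_Mapping.lookup t []"
  for s t :: "'x list \<Rightarrow>\<^sub>0 'a::comm_ring_1"
proof (induction s rule: poly_mapping_additive_induct)
  case (single v c)
  show ?case
    by (induction t rule: poly_mapping_additive_induct)
       (auto simp: mult_single plus_list_def lookup_single when_def lookup_add distrib_left)
qed (simp add: lookup_add distrib_right)

text \<open>The relations consist of words of length one or two, and taking the constant term is
  additive and multiplicative. Its kernel is therefore an ideal that contains them. In particular a
  scalar in the exterior ideal is zero.\<close>

lemma lookup_Nil_exterior_ideal:
  fixes t :: "'a::comm_ring_1 vec list \<Rightarrow>\<^sub>0 'a"
  assumes "t \<in> exterior_ideal m"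
  shows "Poly_Mapping.lookup t [] = 0"
proof -
  let ?R = "free_algebra (carrier_vec m) :: ('a vec list \<Rightarrow>\<^sub>0 'a) ring"
  interpret R: ring ?R
    by (rule ring_free_algebra)
  define J where "J = {t \<in> carrier ?R. Poly_Mapping.lookup t [] = 0}"
  have inv: "\<ominus>\<^bsub>?R\<^esub> x = - x" if "x \<in> carrier ?R" for x
    by (rule R.minus_equality) (use that in simp_all)
  have "ideal J ?R"
  proof (rule idealI[OF ring_free_algebra])
    show "subgroup J (add_monoid ?R)"
    proof (rule group.subgroupI[OF R.add.is_group])
      fix x assume "x \<in> J"
      moreover from this have "inv\<^bsub>add_monoid ?R\<^esub> x = - x"
        using inv[of x] by (auto simp: J_def a_inv_def)
      ultimately show "inv\<^bsub>add_monoid ?R\<^esub> x \<in> J"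
        by (simp add: J_def)
    next
      have "0 \<in> J"
        by (simp add: J_def)
      thus "J \<noteq> {}"
        by blast
    qed (auto simp: J_def lookup_add)
  qed (auto simp: J_def lookup_Nil_mult)
  moreover have "exterior_relations m \<subseteq> J"
  proof
    fix x :: "'a vec list \<Rightarrow>\<^sub>0 'a" assume "x \<in> exterior_relations m"
    thus "x \<in> J"
      using exterior_relations_carrier[of m]
      by (auto simp: J_def exterior_relations_def lookup_minus lookup_single when_def)
  qed
  ultimately have "exterior_ideal m \<subseteq> J"
    unfolding exterior_ideal_def by (rule R.genideal_minimal)
  thus ?thesis
    using assms by (auto simp: J_def)
qed

section \<open>The basis words and the Suslin recursion\<close>

text \<open>Combinations are formed in the free algebra, not in the quotient, so that identities
  between classes become memberships in \<open>exterior_ideal\<close>;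
  \<open>list_lincomb_ext_class\<close> makes the transition.\<close>

definition word_comb :: "'x list list \<Rightarrow> 'a::comm_ring_1 vec \<Rightarrow> ('x list \<Rightarrow>\<^sub>0 'a)" where
  "word_comb ws c = (\<Sum>i<length ws. Poly_Mapping.single (ws ! i) (c $ i))"

lemma word_comb_append:
  assumes "c \<in> carrier_vec (length ws)" "d \<in> carrier_vec (length zs)"
  shows "word_comb (ws @ zs) (c @\<^sub>v d) = word_comb ws c + word_comb zs d"
  unfolding word_comb_def length_append sum_lessThan_add
  using assms by (auto simp: nth_append intro!: arg_cong2[where f = "(+)"] sum.cong)

lemma word_comb_map_Cons:
  "word_comb (map ((#) x) ws) c = Poly_Mapping.single [x] 1 * word_comb ws c"
  by (simp add: word_comb_def sum_distrib_left mult_single plus_list_def)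

lemma word_comb_add:
  "c \<in> carrier_vec (length ws) \<Longrightarrow> d \<in> carrier_vec (length ws) \<Longrightarrow>
    word_comb ws (c + d) = word_comb ws c + word_comb ws d"
  by (simp add: word_comb_def single_add sum.distrib)

lemma word_comb_smult:
  "c \<in> carrier_vec (length ws) \<Longrightarrow>
    word_comb ws (r \<cdot>\<^sub>v c) = Poly_Mapping.single [] r * word_comb ws c"
  by (simp add: word_comb_def sum_distrib_left single_Nil_mult)

lemma word_comb_uminus:
  "c \<in> carrier_vec (length ws) \<Longrightarrow> word_comb ws (- c) = - word_comb ws c"
  by (simp add: word_comb_def single_uminus sum_negf)

lemma word_comb_zero [simp]: "word_comb ws (0\<^sub>v (length ws)) = 0"
  by (simp add: word_comb_def)

lemma word_comb_closed:
  "(\<And>w. w \<in> set ws \<Longrightarrow> set w \<subseteq> X) \<Longrightarrow> word_comb ws c \<in> carrier (free_algebra X)"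
  unfolding word_comb_def by (intro free_algebra_sum single_in_free_algebra) simp

lemma keys_word_comb: "Poly_Mapping.keys (word_comb ws c) \<subseteq> set ws"
proof
  fix w assume "w \<in> Poly_Mapping.keys (word_comb ws c)"
  hence "\<exists>i<length ws. w \<in> Poly_Mapping.keys (Poly_Mapping.single (ws ! i) (c $ i))"
    using keys_sum[of "\<lambda>i. Poly_Mapping.single (ws ! i) (c $ i)" "{..<length ws}"]
    by (fastforce simp: word_comb_def)
  thus "w \<in> set ws"
    by (auto split: if_splits)
qed

text \<open>
  The product with \<open>x\<close> comes second in the even case and first in the odd case: this order matches
  the blocks of the Suslin matrices.
\<close>

fun even_words :: "'x list \<Rightarrow> 'x list list" and odd_words :: "'x list \<Rightarrow> 'x list list" where
  "even_words [] = [[]]"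
| "even_words (x # xs) = even_words xs @ map ((#) x) (odd_words xs)"
| "odd_words [] = []"
| "odd_words (x # xs) = map ((#) x) (even_words xs) @ odd_words xs"

text \<open>The empty list is excluded, having one even word and no odd one. A single letter gives
  one of each, and every further letter doubles both numbers.\<close>

lemma length_words:
  "xs \<noteq> [] \<Longrightarrow> length (even_words xs) = 2 ^ (length xs - 1)"
  "xs \<noteq> [] \<Longrightarrow> length (odd_words xs) = 2 ^ (length xs - 1)"
proof -
  have "length (even_words xs) = 2 ^ (length xs - 1) \<and> length (odd_words xs) = 2 ^ (length xs - 1)"
    if "xs \<noteq> []"
    using that
  proof (induction xs rule: list_nonempty_induct)
    case (cons x xs)
    thus ?case by (cases xs) auto
  qed simp
  thus "xs \<noteq> [] \<Longrightarrow> length (even_words xs) = 2 ^ (length xs - 1)"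
    "xs \<noteq> [] \<Longrightarrow> length (odd_words xs) = 2 ^ (length xs - 1)"
    by auto
qed

lemma set_words:
  "w \<in> set (even_words xs) \<Longrightarrow> set w \<subseteq> set xs \<and> even (length w)"
  "w \<in> set (odd_words xs) \<Longrightarrow> set w \<subseteq> set xs \<and> odd (length w)"
  by (induction xs arbitrary: w) (auto, blast+)

lemma word_comb_words_closed:
  assumes "set xs \<subseteq> X"
  shows "word_comb (even_words xs) c \<in> carrier (free_algebra X)"
    "word_comb (odd_words xs) c \<in> carrier (free_algebra X)"
  using set_words[of _ xs] assms by (blast intro!: word_comb_closed)+

section \<open>Size, transpose and block action of the Suslin matrices\<close>

lemma suslin_carrier: "k \<noteq> 0 \<Longrightarrow> suslin k u v \<in> carrier_mat (2 ^ (k - 1)) (2 ^ (k - 1))"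
proof (induction k u v rule: suslin.induct)
  case (3 k u v)
  show ?case
    using four_block_carrier_mat[of "u $ 0 \<cdot>\<^sub>m 1\<^sub>m (2 ^ k)" "2 ^ k" "2 ^ k"
        "v $ 0 \<cdot>\<^sub>m 1\<^sub>m (2 ^ k)" "2 ^ k" "2 ^ k"]
    by (simp add: Let_def mult_2)
qed simp_all

text \<open>Exchanging u and v swaps the diagonal entries, and transposing swaps the off-diagonal
  blocks. Hence the lower left block of \<open>suslin\<close> is minus a \<open>suslin_bar\<close>
  of the shorter vectors, and the two families satisfy a simultaneous recursion.\<close>

lemma suslin_bar_eq_transpose: "suslin_bar k u v = transpose_mat (suslin k v u)"
proof (cases "(k, u, v)" rule: suslin_bar.cases)
  case (3 k' u' v')
  have *: "suslin (Suc k') a b \<in> carrier_mat (2 ^ k') (2 ^ k')" for a b :: "'a vec"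
    using suslin_carrier[of "Suc k'" a b] by simp
  have "transpose_mat (- transpose_mat (suslin (Suc k') a b)) = - suslin (Suc k') a b" for a b :: "'a vec"
    by (rule eq_matI) auto
  moreover have "transpose_mat (r \<cdot>\<^sub>m 1\<^sub>m (2 ^ k')) = r \<cdot>\<^sub>m (1\<^sub>m (2 ^ k') :: 'a mat)" for r
    by (rule eq_matI) auto
  ultimately show ?thesis
    using 3 *
    by (simp add: Let_def transpose_four_block_mat[where ?nr1.0 = "2 ^ k'" and ?nc1.0 = "2 ^ k'"
          and ?nr2.0 = "2 ^ k'" and ?nc2.0 = "2 ^ k'"])
qed auto

lemma suslin_bar_carrier:
  "k \<noteq> 0 \<Longrightarrow> suslin_bar k u v \<in> carrier_mat (2 ^ (k - 1)) (2 ^ (k - 1))"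
  using suslin_carrier[of k v u] by (simp add: suslin_bar_eq_transpose)

lemma vec_last_vCons: "v \<in> carrier_vec k \<Longrightarrow> vec_last (vCons a v) k = v"
  by (rule eq_vecI) (auto simp: vec_last_def)

lemma smult_one_mult_mat_vec: "v \<in> carrier_vec k \<Longrightarrow> (r \<cdot>\<^sub>m 1\<^sub>m k) *\<^sub>v v = r \<cdot>\<^sub>v v"
  for v :: "'a::comm_ring_1 vec"
  by (rule eq_vecI) (auto simp: scalar_prod_left_unit)

text \<open>The simultaneous recursion in coordinates. The halves \<open>c\<close> and
  \<open>d\<close> will belong to the words with and without the first letter, in the order fixed by
  \<open>odd_words\<close> and \<open>even_words\<close>.\<close>

lemma suslin_mult_append:
  fixes u v :: "'a::comm_ring_1 vec"
  assumes "u \<in> carrier_vec (Suc k)" "v \<in> carrier_vec (Suc k)"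
    and c: "c \<in> carrier_vec (2 ^ k)" and d: "d \<in> carrier_vec (2 ^ k)"
  shows "suslin (Suc (Suc k)) (vCons r u) (vCons s v) *\<^sub>v (c @\<^sub>v d) =
      (r \<cdot>\<^sub>v c + suslin (Suc k) u v *\<^sub>v d) @\<^sub>v (- (suslin_bar (Suc k) u v *\<^sub>v c) + s \<cdot>\<^sub>v d)"
    and "suslin_bar (Suc (Suc k)) (vCons r u) (vCons s v) *\<^sub>v (c @\<^sub>v d) =
      (s \<cdot>\<^sub>v c + - (suslin (Suc k) u v *\<^sub>v d)) @\<^sub>v (suslin_bar (Suc k) u v *\<^sub>v c + r \<cdot>\<^sub>v d)"
proof -
  have *: "suslin (Suc k) a b \<in> carrier_mat (2 ^ k) (2 ^ k)" for a b :: "'a vec"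
    using suslin_carrier[of "Suc k" a b] by simp
  hence dims: "dim_row (suslin (Suc k) a b) = 2 ^ k" "dim_col (suslin (Suc k) a b) = 2 ^ k" for a b :: "'a vec"
    by auto
  show "suslin (Suc (Suc k)) (vCons r u) (vCons s v) *\<^sub>v (c @\<^sub>v d) =
      (r \<cdot>\<^sub>v c + suslin (Suc k) u v *\<^sub>v d) @\<^sub>v (- (suslin_bar (Suc k) u v *\<^sub>v c) + s \<cdot>\<^sub>v d)"
    using assms * dims
    by (simp add: Let_def vec_last_vCons suslin_bar_eq_transpose[of "Suc k"] smult_one_mult_mat_vec
        four_block_mat_mult_vec[where ?nr1.0 = "2 ^ k" and ?nc1.0 = "2 ^ k"
          and ?nr2.0 = "2 ^ k" and ?nc2.0 = "2 ^ k"])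
  show "suslin_bar (Suc (Suc k)) (vCons r u) (vCons s v) *\<^sub>v (c @\<^sub>v d) =
      (s \<cdot>\<^sub>v c + - (suslin (Suc k) u v *\<^sub>v d)) @\<^sub>v (suslin_bar (Suc k) u v *\<^sub>v c + r \<cdot>\<^sub>v d)"
    using assms * dims
    by (simp add: Let_def vec_last_vCons suslin_bar_eq_transpose[of "Suc k"] smult_one_mult_mat_vec
        four_block_mat_mult_vec[where ?nr1.0 = "2 ^ k" and ?nc1.0 = "2 ^ k"
          and ?nr2.0 = "2 ^ k" and ?nc2.0 = "2 ^ k"])
qed

section \<open>Multiplication plus contraction on the basis words\<close>

lemma contract_free_Cons:
  "contract_free \<phi> (Poly_Mapping.single [x] 1 * t) =
     Poly_Mapping.single [] (\<phi> x) * t - Poly_Mapping.single [x] 1 * contract_free \<phi> t"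
  by (simp add: contract_free_mult contract_free_single contract_word_def grade_inv_single
      single_Nil_mult single_uminus)

lemma word_comb_vectors_anticommute:
  assumes "x \<in> carrier_vec m" "set xs \<subseteq> carrier_vec m"
  shows "Poly_Mapping.single [x] 1 * word_comb (map (\<lambda>y. [y]) xs) q +
    word_comb (map (\<lambda>y. [y]) xs) q * Poly_Mapping.single [x] 1 \<in> exterior_ideal m"
proof -
  have "(\<Sum>i<length xs. Poly_Mapping.single [x, xs ! i] (q $ i) + Poly_Mapping.single [xs ! i, x] (q $ i))
      \<in> exterior_ideal m"
    by (rule exterior_ideal_sum, rule single_anticommute_in_ideal) (use assms in auto)
  thus ?thesis
    by (simp add: word_comb_def sum_distrib_left sum_distrib_right mult_single plus_list_def
        sum.distrib)
qed

lemma carrier_vec_Suc_cases: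
  assumes "v \<in> carrier_vec (Suc k)"
  obtains a w where "w \<in> carrier_vec k" "v = vCons a w"
  using assms by (cases v) auto

text \<open>
  If \<open>r\<close> is the coefficient of \<open>x\<close> in the vector, then modulo \<open>x \<and> x = 0\<close> the operator \<open>\<Phi> = l + d\<close>
  satisfies \<open>\<Phi> (x \<and> \<omega> + \<eta>) = (\<phi> x \<omega> + \<Phi>' \<eta>) + x \<and> (r \<eta> - \<Phi>' \<omega>)\<close> for \<open>\<omega>\<close>, \<open>\<eta>\<close> in the
  subalgebra generated by \<open>xs\<close>, where \<open>\<Phi>'\<close> is \<open>\<Phi>\<close> on that subalgebra.
\<close>

lemma clifford_words:
  fixes \<phi> :: "'a::comm_ring_1 vec \<Rightarrow> 'a"
  assumes "xs \<noteq> []" "set xs \<subseteq> carrier_vec m" "q \<in> carrier_vec (length xs)"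
    "c \<in> carrier_vec (2 ^ (length xs - 1))"
  shows "word_comb (map (\<lambda>y. [y]) xs) q * word_comb (odd_words xs) c
        + contract_free \<phi> (word_comb (odd_words xs) c)
        - word_comb (even_words xs) (suslin (length xs) (vec_of_list (map \<phi> xs)) q *\<^sub>v c)
      \<in> exterior_ideal m" (is ?A)
    and "word_comb (map (\<lambda>y. [y]) xs) q * word_comb (even_words xs) c
        + contract_free \<phi> (word_comb (even_words xs) c)
        - word_comb (odd_words xs) (suslin_bar (length xs) (vec_of_list (map \<phi> xs)) q *\<^sub>v c)
      \<in> exterior_ideal m" (is ?B)
proof -
  \<comment> \<open>Both parities go into one induction, since the step for either uses the
    hypotheses for both.\<close>
  have "?A \<and> ?B"
    using assms
  proof (induction xs arbitrary: q c rule: list_nonempty_induct)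
    case (single x)
    \<comment> \<open>In the odd case multiplication gives a multiple of the square of x, so that
      only the contraction survives.\<close>
    have "Poly_Mapping.single [x, x] (q $ 0 * c $ 0) =
        Poly_Mapping.single [] (q $ 0 * c $ 0) * Poly_Mapping.single [x, x] 1"
      by (simp add: single_Nil_mult)
    also have "\<dots> \<in> exterior_ideal m"
      using single by (intro exterior_ideal_lmult single_square_in_ideal) auto
    finally show ?case
      using single
      by (simp add: word_comb_def mult_single plus_list_def contract_free_single contract_word_def
          single_Nil_mult scalar_prod_def row_def mult.commute)
  next
    case (cons x xs)
    obtain k where k: "length xs = Suc k"
      using cons.hyps by (cases xs) auto
    define u where "u = vec_of_list (map \<phi> xs)"
    have u: "u \<in> carrier_vec (Suc k)"
      by (simp add: u_def k carrier_vecI)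
    obtain r p where q: "q = vCons r p" and p: "p \<in> carrier_vec (Suc k)"
      using cons.prems(2) k by (auto elim: carrier_vec_Suc_cases)
    define c1 c2 where "c1 = vec_first c (2 ^ k)" and "c2 = vec_last c (2 ^ k)"
    have c12: "c1 \<in> carrier_vec (2 ^ k)" "c2 \<in> carrier_vec (2 ^ k)"
      by (simp_all add: c1_def c2_def)
    have c: "c = c1 @\<^sub>v c2"
      using cons.prems(3) k unfolding c1_def c2_def
      by (subst vec_first_last_append) (simp_all add: mult_2)
    have len: "length (even_words xs) = 2 ^ k" "length (odd_words xs) = 2 ^ k"
      using length_words[OF cons.hyps] k by simp_all
    have xs: "x \<in> carrier_vec m" "set xs \<subseteq> carrier_vec m"
      using cons.prems(1) by auto
    let ?x = "Poly_Mapping.single [x] (1::'a)" and ?r = "Poly_Mapping.single [] r"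
    define L where "L = word_comb (map (\<lambda>y. [y]) xs) p"
    have L: "word_comb (map (\<lambda>y. [y]) (x # xs)) q = ?r * ?x + L"
      unfolding q L_def word_comb_def
      by (simp add: sum.lessThan_Suc_shift single_Nil_mult del: sum.lessThan_Suc)
    define E :: "'a vec \<Rightarrow> _" where "E = word_comb (even_words xs)"
    define D :: "'a vec \<Rightarrow> _" where "D = word_comb (odd_words xs)"
    have comb: "word_comb (even_words (x # xs)) (d1 @\<^sub>v d2) = E d1 + ?x * D d2"
        "word_comb (odd_words (x # xs)) (d1 @\<^sub>v d2) = ?x * E d1 + D d2"
      if "d1 \<in> carrier_vec (2 ^ k)" "d2 \<in> carrier_vec (2 ^ k)" for d1 d2
      using that len by (simp_all add: word_comb_append word_comb_map_Cons E_def D_def)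
    have closed: "E d \<in> carrier (free_algebra (carrier_vec m))" "D d \<in> carrier (free_algebra (carrier_vec m))" for d
      using word_comb_words_closed[OF xs(2)] by (simp_all add: E_def D_def)
    have lin: "E (d1 + d2) = E d1 + E d2" "D (d1 + d2) = D d1 + D d2"
        "E (- d1) = - E d1" "D (- d1) = - D d1"
        "E (a \<cdot>\<^sub>v d1) = Poly_Mapping.single [] a * E d1" "D (a \<cdot>\<^sub>v d1) = Poly_Mapping.single [] a * D d1"
      if "d1 \<in> carrier_vec (2 ^ k)" "d2 \<in> carrier_vec (2 ^ k)" for d1 d2 a
      using that len
      by (simp_all add: E_def D_def word_comb_add word_comb_uminus word_comb_smult)
    let ?S = "suslin (Suc k) u p" and ?S' = "suslin_bar (Suc k) u p"
    have S: "?S *\<^sub>v d \<in> carrier_vec (2 ^ k)" "?S' *\<^sub>v d \<in> carrier_vec (2 ^ k)"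
      if "d \<in> carrier_vec (2 ^ k)" for d
      using that suslin_carrier[of "Suc k" u p] suslin_bar_carrier[of "Suc k" u p]
      by (auto intro: mult_mat_vec_carrier)
    have IH: "L * D d + contract_free \<phi> (D d) - E (?S *\<^sub>v d) \<in> exterior_ideal m"
        "L * E d + contract_free \<phi> (E d) - D (?S' *\<^sub>v d) \<in> exterior_ideal m"
      if "d \<in> carrier_vec (2 ^ k)" for d
      using cons.IH[OF xs(2), of p d] that p k
      by (simp_all add: L_def E_def D_def u_def)
    have anti: "(?x * L + L * ?x) * t \<in> exterior_ideal m"
      if "t \<in> carrier (free_algebra (carrier_vec m))" for t
      using word_comb_vectors_anticommute[OF xs] that unfolding L_def by (rule exterior_ideal_rmult)
    have square: "?r * ((?x * ?x) * t) \<in> exterior_ideal m"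
      if "t \<in> carrier (free_algebra (carrier_vec m))" for t
    proof -
      have "?x * ?x \<in> exterior_ideal m"
        using single_square_in_ideal[OF xs(1)] by (simp add: mult_single plus_list_def)
      thus ?thesis
        by (intro exterior_ideal_lmult[OF _ exterior_ideal_rmult[OF _ that]]) auto
    qed
    have x_carrier: "?x \<in> carrier (free_algebra (carrier_vec m))"
      using xs by auto
    have commute: "?x * (Poly_Mapping.single [] a * t) = Poly_Mapping.single [] a * (?x * t)" for a t
      by (simp add: single_Nil_mult_left_commute)
    have A: "(?r * ?x + L) * (?x * E c1 + D c2) + contract_free \<phi> (?x * E c1 + D c2)
        - (E (\<phi> x \<cdot>\<^sub>v c1 + ?S *\<^sub>v c2) + ?x * D (- (?S' *\<^sub>v c1) + r \<cdot>\<^sub>v c2)) \<in> exterior_ideal m"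
    proof -
      \<comment> \<open>Write \<open>L * ?x\<close> as the anticommutator minus
        \<open>?x * L\<close>. Besides square and anticommutator, what remains is the hypothesis for
        \<open>c1\<close>, multiplied by \<open>- ?x\<close>, and the one for
        \<open>c2\<close>.\<close>
      have "?r * ((?x * ?x) * E c1) + (?x * L + L * ?x) * E c1
          - ?x * (L * E c1 + contract_free \<phi> (E c1) - D (?S' *\<^sub>v c1))
          + (L * D c2 + contract_free \<phi> (D c2) - E (?S *\<^sub>v c2)) \<in> exterior_ideal m"
        by (intro exterior_ideal_add exterior_ideal_diff square anti closed IH c12
            exterior_ideal_lmult[OF x_carrier])
      thus ?thesis
        using c12 S
        by (simp add: lin contract_free_add contract_free_Cons algebra_simps commute)
    qed
    have B: "(?r * ?x + L) * (E c1 + ?x * D c2) + contract_free \<phi> (E c1 + ?x * D c2)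
        - (?x * E (r \<cdot>\<^sub>v c1 + - (?S *\<^sub>v c2)) + D (?S' *\<^sub>v c1 + \<phi> x \<cdot>\<^sub>v c2)) \<in> exterior_ideal m"
    proof -
      \<comment> \<open>Here the odd part carries the first letter, so the hypothesis for
        \<open>c2\<close> is the one multiplied by \<open>- ?x\<close>.\<close>
      have "?r * ((?x * ?x) * D c2) + (?x * L + L * ?x) * D c2
          - ?x * (L * D c2 + contract_free \<phi> (D c2) - E (?S *\<^sub>v c2))
          + (L * E c1 + contract_free \<phi> (E c1) - D (?S' *\<^sub>v c1)) \<in> exterior_ideal m"
        by (intro exterior_ideal_add exterior_ideal_diff square anti closed IH c12
            exterior_ideal_lmult[OF x_carrier])
      thus ?thesis
        using c12 S
        by (simp add: lin contract_free_add contract_free_Cons algebra_simps commute)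
    qed
    have uv: "vec_of_list (map \<phi> (x # xs)) = vCons (\<phi> x) u" "length (x # xs) = Suc (Suc k)"
      by (simp_all add: u_def k)
    show ?case
      unfolding L uv unfolding c q suslin_mult_append[OF u p c12]
      using A B c12 S by (simp add: comb del: even_words.simps odd_words.simps)
  qed
  thus ?A ?B
    by auto
qed

section \<open>Spanning and linear independence\<close>

lemma vector_expansion:
  fixes v :: "'a::comm_ring_1 vec"
  assumes v: "v \<in> carrier_vec m" and "distinct is" "set is = {..<m}"
  shows "Poly_Mapping.single [v] 1 -
      word_comb (map (\<lambda>y. [y]) (map (unit_vec m) is)) (vec (length is) (\<lambda>k. v $ (is ! k)))
    \<in> exterior_ideal m"
proof -
  \<comment> \<open>The relations give additivity for two summands only, so the coordinates are
    switched on one at a time; J holds those already present.\<close>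
  have "Poly_Mapping.single [vec m (\<lambda>i. if i \<in> J then v $ i else 0)] 1 -
      (\<Sum>i\<in>J. Poly_Mapping.single [unit_vec m i] (v $ i)) \<in> exterior_ideal m"
    if "finite J" "J \<subseteq> {..<m}" for J
    using that
  proof (induction J rule: finite_induct)
    case empty
    \<comment> \<open>The scaling relation with factor 0 puts the letter of the zero vector into the
      ideal.\<close>
    have "(0::'a) \<cdot>\<^sub>v 0\<^sub>v m = 0\<^sub>v m" "vec m (\<lambda>i. 0) = (0\<^sub>v m :: 'a vec)"
      by auto
    thus ?case
      using single_smult_in_ideal[of "0\<^sub>v m" m "0::'a"] by simp
  next
    case (insert j J)
    let ?w = "\<lambda>J. vec m (\<lambda>i. if i \<in> J then v $ i else 0)"
    let ?s = "\<Sum>i\<in>J. Poly_Mapping.single [unit_vec m i] (v $ i)"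
    let ?e = "v $ j \<cdot>\<^sub>v unit_vec m j"
    have w: "?w (insert j J) = ?e + ?w J"
      using insert by (intro eq_vecI) auto
    have "(Poly_Mapping.single [?e + ?w J] 1 - Poly_Mapping.single [?e] 1 - Poly_Mapping.single [?w J] 1)
        + (Poly_Mapping.single [?e] 1 - Poly_Mapping.single [unit_vec m j] (v $ j))
        + (Poly_Mapping.single [?w J] 1 - ?s) \<in> exterior_ideal m"
      using insert by (intro exterior_ideal_add single_add_in_ideal single_smult_in_ideal) auto
    thus ?case
      unfolding w using insert.hyps by (simp add: algebra_simps)
  qed
  from this[of "{..<m}"] have "Poly_Mapping.single [vec m (\<lambda>i. if i < m then v $ i else 0)] 1 -
      (\<Sum>i<m. Poly_Mapping.single [unit_vec m i] (v $ i)) \<in> exterior_ideal m"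
    by simp
  also have "vec m (\<lambda>i. if i < m then v $ i else 0) = v"
    using v by (intro eq_vecI) auto
  also have "(\<Sum>i<m. Poly_Mapping.single [unit_vec m i] (v $ i)) =
      (\<Sum>k<length is. Poly_Mapping.single [unit_vec m (is ! k)] (v $ (is ! k)))"
    by (rule sum.reindex_bij_betw[symmetric], rule bij_betw_nth) (use assms in auto)
  finally show ?thesis
    by (simp add: word_comb_def)
qed

text \<open>Serves both for the zero functional and for a coordinate that vanishes on all letters
  involved.\<close>

lemma contract_free_vanish:
  assumes "\<And>w x. w \<in> Poly_Mapping.keys t \<Longrightarrow> x \<in> set w \<Longrightarrow> \<phi> x = 0"
  shows "contract_free \<phi> t = 0"
  using assms unfolding contract_free_def contract_word_def by (intro sum.neutral) auto

lemma word_comb_unit: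
  assumes "i < length ws"
  shows "word_comb ws (r \<cdot>\<^sub>v unit_vec (length ws) i) = Poly_Mapping.single (ws ! i) r"
proof -
  have "word_comb ws (r \<cdot>\<^sub>v unit_vec (length ws) i) =
      (\<Sum>j<length ws. if j = i then Poly_Mapping.single (ws ! i) r else 0)"
    unfolding word_comb_def using assms by (intro sum.cong) auto
  thus ?thesis
    using assms by simp
qed

lemma Nil_in_even_words: "[] \<in> set (even_words xs)"
  by (induction xs) auto

text \<open>Induction on the word; the parity alternates with each letter, whence the Boolean index
  of \<open>ws\<close>. The new first letter is expanded in the standard basis, and multiplication
  by this expansion is \<open>clifford_words\<close> with the zero functional.\<close>

lemma word_in_span:
  fixes c :: "'a::comm_ring_1"
  assumes "is": "is \<noteq> []" "distinct is" "set is = {..<m}" and w: "set w \<subseteq> carrier_vec m"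
  defines "ws \<equiv> \<lambda>e. if e then even_words (map (unit_vec m) is) else odd_words (map (unit_vec m) is)"
  shows "\<exists>d\<in>carrier_vec (2 ^ (length is - 1)).
    Poly_Mapping.single w c - word_comb (ws (even (length w))) d \<in> exterior_ideal m"
  using w
proof (induction w)
  case Nil
  obtain i where i: "i < length (ws True)" "ws True ! i = []"
    using Nil_in_even_words[of "map (unit_vec m) is"] by (auto simp: ws_def in_set_conv_nth)
  have "length (ws True) = 2 ^ (length is - 1)"
    using "is" by (simp add: ws_def length_words)
  thus ?case
    using i word_comb_unit[OF i(1), of c]
    by (intro bexI[of _ "c \<cdot>\<^sub>v unit_vec (length (ws True)) i"]) auto
next
  case (Cons v w)
  let ?xs = "map (unit_vec m) is :: 'a vec list"
  let ?e = "even (length w)" and ?v = "Poly_Mapping.single [v] (1::'a)"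
  have xs: "?xs \<noteq> []" "set ?xs \<subseteq> carrier_vec m"
    using "is"(1) by (simp, auto)
  have v: "v \<in> carrier_vec m" and v': "?v \<in> carrier (free_algebra (carrier_vec m))"
    using Cons.prems by auto
  obtain d where d: "d \<in> carrier_vec (2 ^ (length is - 1))"
      "Poly_Mapping.single w c - word_comb (ws ?e) d \<in> exterior_ideal m"
    using Cons by auto
  define q where "q = vec (length is) (\<lambda>k. v $ (is ! k))"
  let ?L = "word_comb (map (\<lambda>y. [y]) ?xs) q"
  let ?D = "word_comb (ws ?e) d"
  have D: "?D \<in> carrier (free_algebra (carrier_vec m))"
    unfolding ws_def using word_comb_words_closed[OF xs(2), of d] by simp
  obtain d' where d': "d' \<in> carrier_vec (2 ^ (length is - 1))"
      "?L * ?D - word_comb (ws (\<not> ?e)) d' \<in> exterior_ideal m"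
  proof (cases ?e)
    case True
    \<comment> \<open>For the functional 0 the contraction disappears, and the matrix describes
      multiplication by \<open>?L\<close> alone.\<close>
    let ?d' = "suslin_bar (length ?xs) (vec_of_list (map (\<lambda>_. 0) ?xs)) q *\<^sub>v d"
    have "?d' \<in> carrier_vec (2 ^ (length is - 1))"
      using suslin_bar_carrier[of "length is" _ q] d(1) "is"(1)
      by (auto intro!: mult_mat_vec_carrier)
    moreover have "?L * ?D - word_comb (ws (\<not> ?e)) ?d' \<in> exterior_ideal m"
      using clifford_words(2)[OF xs, of q d "\<lambda>_. 0"] d(1) True
      by (simp add: ws_def q_def contract_free_vanish)
    ultimately show thesis ..
  next
    case False
    let ?d' = "suslin (length ?xs) (vec_of_list (map (\<lambda>_. 0) ?xs)) q *\<^sub>v d"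
    have "?d' \<in> carrier_vec (2 ^ (length is - 1))"
      using suslin_carrier[of "length is" _ q] d(1) "is"(1)
      by (auto intro!: mult_mat_vec_carrier)
    moreover have "?L * ?D - word_comb (ws (\<not> ?e)) ?d' \<in> exterior_ideal m"
      using clifford_words(1)[OF xs, of q d "\<lambda>_. 0"] d(1) False
      by (simp add: ws_def q_def contract_free_vanish)
    ultimately show thesis ..
  qed
  \<comment> \<open>Telescoping: replace w by its combination, then v by its expansion, then the
    product by a combination of the other parity.\<close>
  have "?v * (Poly_Mapping.single w c - ?D) + (?v - ?L) * ?D + (?L * ?D - word_comb (ws (\<not> ?e)) d')
      \<in> exterior_ideal m"
    using d d' v v' D vector_expansion[OF v "is"(2,3)] unfolding q_def
    by (intro exterior_ideal_add exterior_ideal_lmult exterior_ideal_rmult)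
  also have "?v * (Poly_Mapping.single w c - ?D) + (?v - ?L) * ?D + (?L * ?D - word_comb (ws (\<not> ?e)) d')
      = Poly_Mapping.single (v # w) c - word_comb (ws (even (length (v # w)))) d'"
    by (simp add: algebra_simps mult_single plus_list_def)
  finally show ?case
    using d' by blast
qed

lemma odd_words_span:
  fixes t :: "'a::comm_ring_1 vec list \<Rightarrow>\<^sub>0 'a"
  assumes "is": "is \<noteq> []" "distinct is" "set is = {..<m}"
    and t: "t \<in> carrier (free_algebra (carrier_vec m))" "\<And>w. w \<in> Poly_Mapping.keys t \<Longrightarrow> odd (length w)"
  shows "\<exists>d\<in>carrier_vec (2 ^ (length is - 1)).
    t - word_comb (odd_words (map (unit_vec m) is)) d \<in> exterior_ideal m"
proof -
  let ?ws = "odd_words (map (unit_vec m) is) :: 'a vec list list"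
  have len: "length ?ws = 2 ^ (length is - 1)"
    using "is" by (simp add: length_words)
  have "\<exists>d\<in>carrier_vec (2 ^ (length is - 1)).
      (\<Sum>w\<in>K. Poly_Mapping.single w (Poly_Mapping.lookup t w)) - word_comb ?ws d \<in> exterior_ideal m"
    if "finite K" "K \<subseteq> Poly_Mapping.keys t" for K
    using that
  proof (induction K rule: finite_induct)
    case empty
    show ?case
      using word_comb_zero[of ?ws, where ?'b = 'a] unfolding len
      by (intro bexI[of _ "0\<^sub>v (2 ^ (length is - 1))"]) simp_all
  next
    case (insert w K)
    let ?s = "\<Sum>w\<in>K. Poly_Mapping.single w (Poly_Mapping.lookup t w)"
    have w: "set w \<subseteq> carrier_vec m" "odd (length w)"
      using insert.prems t by (auto simp: free_algebra_def)
    obtain d where d: "d \<in> carrier_vec (2 ^ (length is - 1))"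
        "?s - word_comb ?ws d \<in> exterior_ideal m"
      using insert by auto
    obtain d' where d': "d' \<in> carrier_vec (2 ^ (length is - 1))"
        "Poly_Mapping.single w (Poly_Mapping.lookup t w) - word_comb ?ws d' \<in> exterior_ideal m"
      using word_in_span[OF "is" w(1)] w(2) by auto
    have "(Poly_Mapping.single w (Poly_Mapping.lookup t w) - word_comb ?ws d') + (?s - word_comb ?ws d)
        \<in> exterior_ideal m"
      using d d' by (intro exterior_ideal_add)
    thus ?case
      using insert.hyps d d' len
      by (intro bexI[of _ "d' + d"]) (simp_all add: word_comb_add algebra_simps)
  qed
  from this[of "Poly_Mapping.keys t"] show ?thesis
    by (simp add: poly_mapping_eq_sum_single)
qed

section \<open>Linear independence of the basis words\<close>

lemma single_Nil_one: "Poly_Mapping.single [] 1 = (1 :: 'x list \<Rightarrow>\<^sub>0 'a::comm_ring_1)"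
  by (simp flip: zero_list_def)

text \<open>Contraction with \<phi> preserves the ideal and sends the given element to s, because
  \<phi> x = 1 and both s and t are annihilated. Subtracting the product of x and s then leaves
  t.\<close>

lemma contract_split:
  fixes \<phi> :: "'a::comm_ring_1 vec \<Rightarrow> 'a"
  assumes \<phi>: "\<And>u v. u \<in> carrier_vec m \<Longrightarrow> v \<in> carrier_vec m \<Longrightarrow> \<phi> (u + v) = \<phi> u + \<phi> v"
      "\<And>r v. v \<in> carrier_vec m \<Longrightarrow> \<phi> (r \<cdot>\<^sub>v v) = r * \<phi> v"
    and "\<phi> x = 1" "x \<in> carrier_vec m"
    and "contract_free \<phi> s = 0" "contract_free \<phi> t = 0"
    and st: "Poly_Mapping.single [x] 1 * s + t \<in> exterior_ideal m"
  shows "s \<in> exterior_ideal m" "t \<in> exterior_ideal m"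
proof -
  have "contract_free \<phi> (Poly_Mapping.single [x] 1 * s + t) \<in> exterior_ideal m"
    by (rule contract_ideal) (use assms in auto)
  thus s: "s \<in> exterior_ideal m"
    using assms by (simp add: contract_free_add contract_free_Cons single_Nil_one)
  have "Poly_Mapping.single [x] 1 * s + t - Poly_Mapping.single [x] 1 * s \<in> exterior_ideal m"
    using assms(4) by (intro exterior_ideal_diff st exterior_ideal_lmult s) auto
  thus "t \<in> exterior_ideal m"
    by simp
qed

text \<open>The list \<open>is\<close> may cover only some of the indices, because the induction
  drops its first entry while m stays fixed. The coordinate functional of that entry separates the
  words containing it from the others.\<close>

lemma words_independent:
  fixes c :: "'a::comm_ring_1 vec"
  assumes "is \<noteq> []" "distinct is" "set is \<subseteq> {..<m}" "c \<in> carrier_vec (2 ^ (length is - 1))"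
  shows "word_comb (odd_words (map (unit_vec m) is)) c \<in> exterior_ideal m \<Longrightarrow>
      c = 0\<^sub>v (2 ^ (length is - 1))" (is "?A \<Longrightarrow> ?C")
    and "word_comb (even_words (map (unit_vec m) is)) c \<in> exterior_ideal m \<Longrightarrow>
      c = 0\<^sub>v (2 ^ (length is - 1))" (is "?B \<Longrightarrow> ?C")
proof -
  have "(?A \<longrightarrow> ?C) \<and> (?B \<longrightarrow> ?C)"
    using assms
  proof (induction "is" arbitrary: c rule: list_nonempty_induct)
    case (single i)
    let ?\<phi> = "\<lambda>v :: 'a vec. v $ i"
    \<comment> \<open>A scalar in the ideal vanishes; the contraction below reduces the odd case to
      this one.\<close>
    have *: "c = 0\<^sub>v 1" if "Poly_Mapping.single [] (c $ 0) \<in> exterior_ideal m"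
      using lookup_Nil_exterior_ideal[OF that] single.prems
      by (intro eq_vecI) auto
    moreover have "Poly_Mapping.single [] (c $ 0) \<in> exterior_ideal m"
      if "Poly_Mapping.single [unit_vec m i] (c $ 0) \<in> exterior_ideal m"
    proof -
      have "contract_free ?\<phi> (Poly_Mapping.single [unit_vec m i] (c $ 0)) \<in> exterior_ideal m"
        by (rule contract_ideal) (use that single in auto)
      thus ?thesis
        using single by (simp add: contract_free_single contract_word_def single_Nil_mult)
    qed
    ultimately show ?case
      by (auto simp: word_comb_def)
  next
    case (cons i "is")
    let ?\<phi> = "\<lambda>v :: 'a vec. v $ i"
    let ?xs = "map (unit_vec m) is :: 'a vec list"
    obtain k where k: "length is = Suc k"
      using cons.hyps by (cases "is") auto
    define c1 c2 where "c1 = vec_first c (2 ^ k)" and "c2 = vec_last c (2 ^ k)"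
    have c12: "c1 \<in> carrier_vec (2 ^ k)" "c2 \<in> carrier_vec (2 ^ k)"
      by (simp_all add: c1_def c2_def)
    have c: "c = c1 @\<^sub>v c2"
      using cons.prems(3) k unfolding c1_def c2_def
      by (subst vec_first_last_append) (simp_all add: mult_2)
    have len: "length (even_words ?xs) = 2 ^ k" "length (odd_words ?xs) = 2 ^ k"
      using length_words[of ?xs] cons.hyps k by simp_all
    \<comment> \<open>By distinctness the coordinate i vanishes on the remaining vectors, so
      contraction kills all combinations of words in them.\<close>
    have "x $ i = 0" if "x \<in> set ?xs" for x
      using that cons.prems by (auto simp: subset_iff)
    moreover have "w \<in> Poly_Mapping.keys (word_comb (even_words ?xs) d) \<Longrightarrow> set w \<subseteq> set ?xs"
        "w \<in> Poly_Mapping.keys (word_comb (odd_words ?xs) d) \<Longrightarrow> set w \<subseteq> set ?xs"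
      for w and d :: "'a vec"
      using set_words[of w ?xs] keys_word_comb[of _ d] by fast+
    ultimately have van: "contract_free ?\<phi> (word_comb (even_words ?xs) d) = 0"
        "contract_free ?\<phi> (word_comb (odd_words ?xs) d) = 0" for d
      by (intro contract_free_vanish; fast)+
    have IH: "word_comb (odd_words ?xs) d \<in> exterior_ideal m \<Longrightarrow> d = 0\<^sub>v (2 ^ k)"
        "word_comb (even_words ?xs) d \<in> exterior_ideal m \<Longrightarrow> d = 0\<^sub>v (2 ^ k)"
      if "d \<in> carrier_vec (2 ^ k)" for d
      using cons.IH[of d] cons.prems(1,2) that unfolding k by fastforce+
    have split: "s \<in> exterior_ideal m \<and> t \<in> exterior_ideal m"
      if "contract_free ?\<phi> s = 0" "contract_free ?\<phi> t = 0"
        "Poly_Mapping.single [unit_vec m i] 1 * s + t \<in> exterior_ideal m" for s t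
      using contract_split[of m ?\<phi> "unit_vec m i" s t] that cons.prems by auto
    have zero: "0\<^sub>v (2 ^ k) @\<^sub>v 0\<^sub>v (2 ^ k) = (0\<^sub>v (2 ^ (length (i # is) - 1)) :: 'a vec)"
      using k by (intro eq_vecI) auto
    show ?case
    proof (intro conjI impI)
      assume "word_comb (odd_words (map (unit_vec m) (i # is))) c \<in> exterior_ideal m"
      hence "Poly_Mapping.single [unit_vec m i] 1 * word_comb (even_words ?xs) c1
          + word_comb (odd_words ?xs) c2 \<in> exterior_ideal m"
        using c12 len by (simp add: c word_comb_append word_comb_map_Cons)
      hence "c1 = 0\<^sub>v (2 ^ k) \<and> c2 = 0\<^sub>v (2 ^ k)"
        using split[OF van] IH c12 by blast
      thus "c = 0\<^sub>v (2 ^ (length (i # is) - 1))"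
        by (simp only: c zero)
    next
      assume "word_comb (even_words (map (unit_vec m) (i # is))) c \<in> exterior_ideal m"
      hence "Poly_Mapping.single [unit_vec m i] 1 * word_comb (odd_words ?xs) c2
          + word_comb (even_words ?xs) c1 \<in> exterior_ideal m"
        using c12 len by (simp add: c word_comb_append word_comb_map_Cons add.commute)
      hence "c1 = 0\<^sub>v (2 ^ k) \<and> c2 = 0\<^sub>v (2 ^ k)"
        using split[OF van(2) van(1)] IH c12 by blast
      thus "c = 0\<^sub>v (2 ^ (length (i # is) - 1))"
        by (simp only: c zero)
    qed
  qed
  thus "?A \<Longrightarrow> ?C" "?B \<Longrightarrow> ?C"
    by blast+
qed

section \<open>Passing to the quotient\<close>

lemma ext_class_cong:
  assumes "s \<in> carrier (free_algebra (carrier_vec m))" "t \<in> carrier (free_algebra (carrier_vec m))"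
    and "s - t \<in> exterior_ideal m"
  shows "ext_class m s = ext_class m t"
proof -
  interpret I: ideal "exterior_ideal m" "free_algebra (carrier_vec m)"
    by (rule ideal_exterior_ideal)
  have "s \<in> ext_class m t"
    unfolding ext_class_def a_r_coset_def' using assms(3) by (auto intro!: bexI[of _ "s - t"])
  thus ?thesis
    unfolding ext_class_def using I.a_repr_independence'[OF _ assms(2)] by simp
qed

lemma ext_class_zero: "ext_class m 0 = exterior_ideal m"
  by (auto simp: ext_class_def a_r_coset_def')

lemma ext_class_eq_idealD:
  assumes "t \<in> carrier (free_algebra (carrier_vec m))" "ext_class m t = exterior_ideal m"
  shows "t \<in> exterior_ideal m"
proof -
  interpret I: ideal "exterior_ideal m" "free_algebra (carrier_vec m)"
    by (rule ideal_exterior_ideal)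
  show ?thesis
    using I.a_rcos_self[OF assms(1)] assms(2) by (simp add: ext_class_def)
qed

lemma exterior_algebra_simps:
  "carrier (exterior_algebra m) = carrier (free_algebra (carrier_vec m) Quot exterior_ideal m)"
  "add (exterior_algebra m) = add (free_algebra (carrier_vec m) Quot exterior_ideal m)"
  "mult (exterior_algebra m) = mult (free_algebra (carrier_vec m) Quot exterior_ideal m)"
  "zero (exterior_algebra m) = zero (free_algebra (carrier_vec m) Quot exterior_ideal m)"
  "smult (exterior_algebra m) r X =
     ext_class m (Poly_Mapping.single [] r) \<otimes>\<^bsub>free_algebra (carrier_vec m) Quot exterior_ideal m\<^esub> X"
  by (simp_all add: exterior_algebra_def Let_def ring.defs module.defs)

lemma ring_hom_ext_class:
  "ring_hom_ring (free_algebra (carrier_vec m) :: ('a::comm_ring_1 vec list \<Rightarrow>\<^sub>0 'a) ring)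
     (free_algebra (carrier_vec m) Quot exterior_ideal m) (ext_class m)"
proof -
  have "(ext_class m :: ('a vec list \<Rightarrow>\<^sub>0 'a) \<Rightarrow> _) = (+>\<^bsub>free_algebra (carrier_vec m)\<^esub>) (exterior_ideal m)"
    by (rule ext) (simp add: ext_class_def)
  thus ?thesis
    using ideal.rcos_ring_hom_ring[OF ideal_exterior_ideal] by simp
qed

text \<open>\<open>ext_class m\<close> is a ring homomorphism and the scalar r acts as
  multiplication by the class of a constant, so the coefficients can be absorbed into the
  words.\<close>

lemma list_lincomb_ext_class:
  fixes c :: "'a::comm_ring_1 vec"
  assumes "\<And>w. w \<in> set ws \<Longrightarrow> set w \<subseteq> carrier_vec m"
  shows "list_lincomb (exterior_algebra m) (map (\<lambda>w. ext_class m (Poly_Mapping.single w 1)) ws) c =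
    ext_class m (word_comb ws c)"
proof -
  let ?Q = "free_algebra (carrier_vec m) Quot exterior_ideal m :: ('a vec list \<Rightarrow>\<^sub>0 'a) set ring"
  interpret h: ring_hom_ring "free_algebra (carrier_vec m)" ?Q "ext_class m"
    by (rule ring_hom_ext_class)
  have ws: "Poly_Mapping.single (ws ! i) r \<in> carrier (free_algebra (carrier_vec m))"
    if "i < length ws" for i and r :: 'a
    using assms that by auto
  have finsum: "finsum ?Q (\<lambda>i. ext_class m (Poly_Mapping.single (ws ! i) (c $ i))) {..<k} =
      ext_class m (\<Sum>i<k. Poly_Mapping.single (ws ! i) (c $ i))" if "k \<le> length ws" for k
    using that
  proof (induction k)
    case 0
    show ?case
      using h.hom_zero by simp
  next
    case (Suc k)
    have closed: "(\<Sum>i<k. Poly_Mapping.single (ws ! i) (c $ i)) \<in> carrier (free_algebra (carrier_vec m))"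
      by (rule free_algebra_sum, rule ws) (use Suc.prems in simp)
    have "finsum ?Q (\<lambda>i. ext_class m (Poly_Mapping.single (ws ! i) (c $ i))) (insert k {..<k}) =
        ext_class m (Poly_Mapping.single (ws ! k) (c $ k)) \<oplus>\<^bsub>?Q\<^esub>
        finsum ?Q (\<lambda>i. ext_class m (Poly_Mapping.single (ws ! i) (c $ i))) {..<k}"
      using Suc.prems by (intro h.S.finsum_insert) (auto intro!: h.hom_closed ws)
    also have "\<dots> = ext_class m (Poly_Mapping.single (ws ! k) (c $ k) + (\<Sum>i<k. Poly_Mapping.single (ws ! i) (c $ i)))"
      using Suc h.hom_add[of "Poly_Mapping.single (ws ! k) (c $ k)", OF _ closed]
      by (simp add: ws)
    finally show ?case
      by (simp add: lessThan_Suc add.commute)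
  qed
  have smult: "smult (exterior_algebra m) r (ext_class m (Poly_Mapping.single (ws ! i) 1)) =
      ext_class m (Poly_Mapping.single (ws ! i) r)" if "i < length ws" for i r
    using h.hom_mult[of "Poly_Mapping.single [] r" "Poly_Mapping.single (ws ! i) 1"] ws[OF that]
    by (simp add: exterior_algebra_simps single_Nil_mult)
  have "list_lincomb (exterior_algebra m) (map (\<lambda>w. ext_class m (Poly_Mapping.single w 1)) ws) c =
      finsum ?Q (\<lambda>i. smult (exterior_algebra m) (c $ i)
        (map (\<lambda>w. ext_class m (Poly_Mapping.single w 1)) ws ! i)) {..<length ws}"
    \<comment> \<open>A finite sum depends only on carrier, addition and zero, which the module
      takes over from the quotient ring.\<close>
    by (simp add: list_lincomb_def finsum_def finprod_def exterior_algebra_simps(1,2,4))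
  also have "\<dots> = finsum ?Q (\<lambda>i. ext_class m (Poly_Mapping.single (ws ! i) (c $ i))) {..<length ws}"
    by (rule h.S.finsum_cong') (auto simp: smult intro!: h.hom_closed ws)
  finally show ?thesis
    by (simp add: finsum word_comb_def)
qed

lemma Phi_ext_class:
  fixes t :: "'a::comm_ring_1 vec list \<Rightarrow>\<^sub>0 'a"
  assumes "p \<in> carrier_vec n" "f \<in> carrier_vec n"
    and t: "t \<in> carrier (free_algebra (carrier_vec (n + 1)))"
  shows "Phi n (p, a, f, b) (ext_class (n + 1) t) =
    ext_class (n + 1) (Poly_Mapping.single [p @\<^sub>v vec 1 (\<lambda>_. a)] 1 * t
      + contract_free (\<lambda>y. (f @\<^sub>v vec 1 (\<lambda>_. b)) \<bullet> y) t)"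
proof -
  let ?m = "n + 1" and ?g = "f @\<^sub>v vec 1 (\<lambda>_. b)" and ?x = "p @\<^sub>v vec 1 (\<lambda>_. a)"
  interpret h: ring_hom_ring "free_algebra (carrier_vec ?m)"
      "free_algebra (carrier_vec ?m) Quot exterior_ideal ?m" "ext_class ?m"
    by (rule ring_hom_ext_class)
  have g: "?g \<in> carrier_vec ?m" and x: "?x \<in> carrier_vec ?m"
    by (intro append_carrier_vec assms vec_carrier)+
  have "contraction ?m (\<lambda>y. ?g \<bullet> y) (ext_class ?m t) = ext_class ?m (contract_free (\<lambda>y. ?g \<bullet> y) t)"
    by (rule contraction_class[OF _ _ t]) (simp_all only: scalar_prod_add_distrib[OF g] scalar_prod_smult_distrib[OF g])
  moreover have x': "Poly_Mapping.single [?x] 1 \<in> carrier (free_algebra (carrier_vec ?m))"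
    using x by auto
  ultimately show ?thesis
    using h.hom_mult[OF x' t] h.hom_add[OF free_algebra_mult[OF x' t] contract_free_closed[OF t]]
    by (simp add: Phi_def left_mult_def exterior_algebra_simps)
qed

text \<open>Putting the index n first moves the summand R to the front. The entries a and b, last in
  the vector and the functional, thereby become the first entries of the Suslin vectors.\<close>

lemma Phi_words:
  fixes p f :: "'a::comm_ring_1 vec"
  assumes p: "p \<in> carrier_vec n" and f: "f \<in> carrier_vec n" and c: "c \<in> carrier_vec (2 ^ n)"
  defines "xs \<equiv> map (unit_vec (n + 1)) (n # [0..<n])"
  shows "Phi n (p, a, f, b) (ext_class (n + 1) (word_comb (odd_words xs) c)) =
      ext_class (n + 1) (word_comb (even_words xs) (suslin (n + 1) (vCons b f) (vCons a p) *\<^sub>v c))"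
    and "Phi n (p, a, f, b) (ext_class (n + 1) (word_comb (even_words xs) c)) =
      ext_class (n + 1) (word_comb (odd_words xs) (suslin_bar (n + 1) (vCons b f) (vCons a p) *\<^sub>v c))"
proof -
  let ?m = "n + 1" and ?g = "f @\<^sub>v vec 1 (\<lambda>_. b)" and ?x = "p @\<^sub>v vec 1 (\<lambda>_. a)"
  let ?is = "n # [0..<n]"
  have g: "?g \<in> carrier_vec ?m" and x: "?x \<in> carrier_vec ?m"
    by (intro append_carrier_vec p f vec_carrier)+
  have xs: "xs \<noteq> []" "set xs \<subseteq> carrier_vec ?m" "length xs = ?m"
    by (auto simp: xs_def)
  have u: "vec_of_list (map (\<lambda>y. ?g \<bullet> y) xs) = vCons b f"
    using f g by (intro eq_vecI) (auto simp: xs_def vec_index_vCons nth_Cons' vec_of_list_index)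
  have q: "vec (length ?is) (\<lambda>k. ?x $ (?is ! k)) = vCons a p"
    using p by (intro eq_vecI) (auto simp: vec_index_vCons nth_Cons')
  have "distinct ?is" "set ?is = {..<?m}"
    by auto
  from vector_expansion[OF x this]
  have expansion: "Poly_Mapping.single [?x] 1 - word_comb (map (\<lambda>y. [y]) xs) (vCons a p) \<in> exterior_ideal ?m"
    unfolding q xs_def .
  \<comment> \<open>\<open>Phi\<close> multiplies by the single letter \<open>[?x]\<close>,
    \<open>clifford_words\<close> by its expansion in basis letters; the difference lies in the
    ideal.\<close>
  have cong: "ext_class ?m (Poly_Mapping.single [?x] 1 * t + contract_free (\<lambda>y. ?g \<bullet> y) t) = ext_class ?m s"
    if t: "t \<in> carrier (free_algebra (carrier_vec ?m))" and s: "s \<in> carrier (free_algebra (carrier_vec ?m))"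
      and ts: "word_comb (map (\<lambda>y. [y]) xs) (vCons a p) * t + contract_free (\<lambda>y. ?g \<bullet> y) t - s \<in> exterior_ideal ?m"
    for s t
  proof (rule ext_class_cong[OF _ s])
    show "Poly_Mapping.single [?x] 1 * t + contract_free (\<lambda>y. ?g \<bullet> y) t \<in> carrier (free_algebra (carrier_vec ?m))"
      using x t by (intro free_algebra_add free_algebra_mult contract_free_closed single_in_free_algebra) auto
    show "Poly_Mapping.single [?x] 1 * t + contract_free (\<lambda>y. ?g \<bullet> y) t - s \<in> exterior_ideal ?m"
      using exterior_ideal_add[OF exterior_ideal_rmult[OF expansion t] ts] by (simp add: algebra_simps)
  qed
  note closed = word_comb_words_closed[OF xs(2)]
  have q': "vCons a p \<in> carrier_vec (length xs)" "c \<in> carrier_vec (2 ^ (length xs - 1))"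
    using p c xs by auto
  show "Phi n (p, a, f, b) (ext_class ?m (word_comb (odd_words xs) c)) =
      ext_class ?m (word_comb (even_words xs) (suslin ?m (vCons b f) (vCons a p) *\<^sub>v c))"
    unfolding Phi_ext_class[OF p f closed(2)]
    using clifford_words(1)[OF xs(1,2) q', where \<phi> = "\<lambda>y. ?g \<bullet> y"] unfolding u xs(3)
    by (intro cong closed)
  show "Phi n (p, a, f, b) (ext_class ?m (word_comb (even_words xs) c)) =
      ext_class ?m (word_comb (odd_words xs) (suslin_bar ?m (vCons b f) (vCons a p) *\<^sub>v c))"
    unfolding Phi_ext_class[OF p f closed(1)]
    using clifford_words(2)[OF xs(1,2) q', where \<phi> = "\<lambda>y. ?g \<bullet> y"] unfolding u xs(3)
    by (intro cong closed)
qed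

section \<open>The matrix of the base point\<close>

lemma suslin_zero: "suslin (Suc k) (0\<^sub>v (Suc k)) (0\<^sub>v (Suc k)) = 0\<^sub>m (2 ^ k) (2 ^ k)"
proof (induction k)
  case 0
  show ?case by (rule eq_matI) auto
next
  case (Suc k)
  have "vec_last (0\<^sub>v (Suc (Suc k)) :: 'a vec) (Suc k) = 0\<^sub>v (Suc k)"
    by (simp add: zero_vec_Suc[of "Suc k"] vec_last_vCons)
  thus ?case
    using Suc by (intro eq_matI) (auto simp: Let_def)
qed

text \<open>The off-diagonal blocks are built from Suslin matrices of zero vectors. Thus the base
  point carries odd to even coordinates, and back, without change.\<close>

lemma suslin_base_point:
  "suslin (n + 1) (vCons 1 (0\<^sub>v n)) (vCons 1 (0\<^sub>v n)) = (1\<^sub>m (2 ^ n) :: 'a::comm_ring_1 mat)"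
  "suslin_bar (n + 1) (vCons 1 (0\<^sub>v n)) (vCons 1 (0\<^sub>v n)) = (1\<^sub>m (2 ^ n) :: 'a::comm_ring_1 mat)"
proof -
  show "suslin (n + 1) (vCons 1 (0\<^sub>v n)) (vCons 1 (0\<^sub>v n)) = (1\<^sub>m (2 ^ n) :: 'a::comm_ring_1 mat)"
  proof (cases n)
    case 0
    thus ?thesis by (intro eq_matI) auto
  next
    case (Suc k)
    thus ?thesis
      by (intro eq_matI) (auto simp: Let_def vec_last_vCons suslin_zero)
  qed
  thus "suslin_bar (n + 1) (vCons 1 (0\<^sub>v n)) (vCons 1 (0\<^sub>v n)) = (1\<^sub>m (2 ^ n) :: 'a::comm_ring_1 mat)"
    unfolding suslin_bar_eq_transpose by simp
qed

theorem theorem3p3: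
  fixes n :: nat
  shows "\<exists>B :: ('a::comm_ring_1 vec list \<Rightarrow>\<^sub>0 'a) set list.
           ordered_basis (exterior_algebra (n + 1)) (exterior_odd (n + 1)) B \<and>
           (\<forall>p\<in>carrier_vec n. \<forall>a. \<forall>f\<in>carrier_vec n. \<forall>b.
              represents (exterior_algebra (n + 1)) B (suslin_endo n (p, a, f, b))
                (suslin (n + 1) (vCons b f) (vCons a p)) \<and>
              represents (exterior_algebra (n + 1)) B (suslin_endo_bar n (p, a, f, b))
                (suslin_bar (n + 1) (vCons b f) (vCons a p)))"
proof -
  let ?m = "n + 1" and ?is = "n # [0..<n]"
  define xs :: "'a vec list" where "xs = map (unit_vec ?m) ?is"
  define B where "B = map (\<lambda>w. ext_class ?m (Poly_Mapping.single w 1)) (odd_words xs)"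
  \<comment> \<open>The even combinations do not occur in the statement; they are the intermediate
    values of the two composites.\<close>
  let ?E = "\<lambda>c :: 'a vec. ext_class ?m (word_comb (even_words xs) c)"
  let ?O = "\<lambda>c :: 'a vec. ext_class ?m (word_comb (odd_words xs) c)"
  have "is": "?is \<noteq> []" "distinct ?is" "set ?is = {..<?m}" "length ?is - 1 = n"
    by auto
  have xs: "set xs \<subseteq> carrier_vec ?m"
    by (auto simp: xs_def)
  have len: "length B = 2 ^ n" "length (odd_words xs) = 2 ^ n"
    using length_words(2)[of xs] by (simp_all add: B_def xs_def del: odd_words.simps)
  note closed = word_comb_words_closed[OF xs]
  have lincomb: "list_lincomb (exterior_algebra ?m) B c = ?O c" for c
    unfolding B_def using set_words(2)[of _ xs] xs by (intro list_lincomb_ext_class) blast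
  \<comment> \<open>\<open>Phi10\<close> and \<open>Phi01\<close> are undefined outside their
    parity, so evaluating them needs these memberships.\<close>
  have odd: "?O c \<in> exterior_odd ?m" and even: "?E c \<in> exterior_even ?m" for c
    unfolding exterior_odd_def exterior_even_def
    using closed[of c] keys_word_comb[of _ c] set_words[of _ xs] by blast+
  have "ordered_basis (exterior_algebra ?m) (exterior_odd ?m) B"
    unfolding ordered_basis_def
  proof (intro conjI ballI impI)
    show "set B \<subseteq> exterior_odd ?m"
    proof
      fix X assume "X \<in> set B"
      then obtain w where "w \<in> set (odd_words xs)" "X = ext_class ?m (Poly_Mapping.single w 1)"
        by (auto simp: B_def)
      thus "X \<in> exterior_odd ?m"
        using set_words(2)[of w xs] xs by (auto simp: exterior_odd_def)
    qed
  next
    fix y :: "('a vec list \<Rightarrow>\<^sub>0 'a) set" assume "y \<in> exterior_odd ?m"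
    then obtain t where t: "t \<in> carrier (free_algebra (carrier_vec ?m))" "y = ext_class ?m t"
        "\<And>w. w \<in> Poly_Mapping.keys t \<Longrightarrow> odd (length w)"
      unfolding exterior_odd_def by blast
    obtain d where "d \<in> carrier_vec (2 ^ n)" "t - word_comb (odd_words xs) d \<in> exterior_ideal ?m"
      using odd_words_span[OF "is"(1,2,3) t(1,3)] unfolding xs_def "is"(4) by blast
    thus "\<exists>c\<in>carrier_vec (length B). y = list_lincomb (exterior_algebra ?m) B c"
      unfolding lincomb len using ext_class_cong[OF t(1) closed(2)] t(2) by blast
  next
    fix c :: "'a vec" assume c: "c \<in> carrier_vec (length B)"
      and "list_lincomb (exterior_algebra ?m) B c = \<zero>\<^bsub>exterior_algebra ?m\<^esub>"
    hence "?O c = exterior_ideal ?m"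
      unfolding lincomb by (simp add: exterior_algebra_simps FactRing_def)
    hence "word_comb (odd_words xs) c \<in> exterior_ideal ?m"
      by (rule ext_class_eq_idealD[OF closed(2)])
    thus "c = 0\<^sub>v (length B)"
      using words_independent(1)[OF "is"(1,2), of ?m c] "is"(3) c
      unfolding len "is"(4) xs_def by blast
  qed
  moreover have "represents (exterior_algebra ?m) B (suslin_endo n (p, a, f, b))
        (suslin ?m (vCons b f) (vCons a p))"
      "represents (exterior_algebra ?m) B (suslin_endo_bar n (p, a, f, b))
        (suslin_bar ?m (vCons b f) (vCons a p))"
    if p: "p \<in> carrier_vec n" and f: "f \<in> carrier_vec n" for p f :: "'a vec" and a b :: 'a
  proof -
    let ?S = "suslin ?m (vCons b f) (vCons a p)" and ?S' = "suslin_bar ?m (vCons b f) (vCons a p)"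
    have S: "?S \<in> carrier_mat (2 ^ n) (2 ^ n)" "?S' \<in> carrier_mat (2 ^ n) (2 ^ n)"
      using suslin_carrier[of ?m] suslin_bar_carrier[of ?m] by simp_all
    note Phi = Phi_words[where ?'a = 'a and n = n, folded xs_def]
    have base: "Phi n (base_point n) (?O c) = ?E c" "Phi n (base_point n) (?E c) = ?O c"
      if "c \<in> carrier_vec (2 ^ n)" for c
      using Phi[OF zero_carrier_vec zero_carrier_vec that, of 1 1] that
      unfolding base_point_def suslin_base_point by simp_all
    \<comment> \<open>The first composite runs from \<open>?O c\<close> through
      \<open>?E (?S *\<^sub>v c)\<close>, the second through \<open>?E c\<close>; in each, the
      factor at the base point leaves the coordinates alone.\<close>
    have "suslin_endo n (p, a, f, b) (?O c) = ?O (?S *\<^sub>v c)"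
      "suslin_endo_bar n (p, a, f, b) (?O c) = ?O (?S' *\<^sub>v c)" if "c \<in> carrier_vec (2 ^ n)" for c
      using that odd even Phi[OF p f that] base[OF that] base(2)[OF mult_mat_vec_carrier[OF S(1) that]]
      by (simp_all add: suslin_endo_def suslin_endo_bar_def compose_def Phi01_def Phi10_def
          del: suslin.simps suslin_bar.simps)
    thus "represents (exterior_algebra ?m) B (suslin_endo n (p, a, f, b)) ?S"
      "represents (exterior_algebra ?m) B (suslin_endo_bar n (p, a, f, b)) ?S'"
      unfolding represents_def lincomb len using S by blast+
  qed
  ultimately show ?thesis
    by blast
qed

end
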